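(* Let $R$ be a finite commutative ring with $1$. Then the category of $\mathrm{VI}(R)$-modules is locally Noetherian.
   Context: All rings are commutative with $1$. An $R$-linear map between free $R$-modules is splittable if it has a left inverse (when it is injective). $\mathrm{VI}(R)$ is the category whose objects are finite-rank free $R$-modules and whose morphisms are the splittable injections, i.e. $R$-linear injections having an $R$-linear left inverse. For a category $\mathsf{C}$ and a ring $\mathbf{k}$, a $\mathsf{C}$-module over $\mathbf{k}$ is a functor $M$ from $\mathsf{C}$ to $\mathbf{k}$-modules, with value $M_C$ at an object $C$; morphisms are natural transformations, and submodules are defined pointwise. $M$ is finitely generated if there are finitely many objects $C_1,\dots,C_n$ and elements $x_i\in M_{C_i}$ such that the smallest $\mathsf{C}$-submodule of $M$ containing all $x_i$ is $M$. The category of $\mathsf{C}$-modules over $\mathbf{k}$ is locally Noetherian if every submodule of a finitely generated $\mathsf{C}$-module over $\mathbf{k}$ is finitely generated. The category of $\mathsf{C}$-modules is locally Noetherian if this holds over every Noetherian ring $\mathbf{k}$. *)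

theory Defs
  imports "HOL-Algebra.Module" "HOL-Algebra.Ring_Divisibility"
begin

section \<open>Categories\<close>

text \<open>In \<open>Comp C x y z g f\<close> the arrow \<open>f\<close> goes from \<open>x\<close> to \<open>y\<close> and \<open>g\<close> from \<open>y\<close> to \<open>z\<close>.\<close>

record ('o, 'm) category_data =
  Obj :: "'o set"
  Hom :: "'o \<Rightarrow> 'o \<Rightarrow> 'm set"
  Ident :: "'o \<Rightarrow> 'm"
  Comp :: "'o \<Rightarrow> 'o \<Rightarrow> 'o \<Rightarrow> 'm \<Rightarrow> 'm \<Rightarrow> 'm"

locale category =
  fixes C :: "('o, 'm) category_data"
  assumes ident_hom: "x \<in> Obj C \<Longrightarrow> Ident C x \<in> Hom C x x"
    and comp_hom: "\<lbrakk>x \<in> Obj C; y \<in> Obj C; z \<in> Obj C; f \<in> Hom C x y; g \<in> Hom C y z\<rbrakk>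
      \<Longrightarrow> Comp C x y z g f \<in> Hom C x z"
    and comp_ident_left: "\<lbrakk>x \<in> Obj C; y \<in> Obj C; f \<in> Hom C x y\<rbrakk>
      \<Longrightarrow> Comp C x y y (Ident C y) f = f"
    and comp_ident_right: "\<lbrakk>x \<in> Obj C; y \<in> Obj C; f \<in> Hom C x y\<rbrakk>
      \<Longrightarrow> Comp C x x y f (Ident C x) = f"
    and comp_assoc: "\<lbrakk>w \<in> Obj C; x \<in> Obj C; y \<in> Obj C; z \<in> Obj C;
        f \<in> Hom C w x; g \<in> Hom C x y; h \<in> Hom C y z\<rbrakk>
      \<Longrightarrow> Comp C w x z (Comp C x y z h g) f = Comp C w y z h (Comp C w x y g f)"

section \<open>Linear maps and free modules of finite rank\<close>

definition linear_maps ::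
  "('a, 'r) ring_scheme \<Rightarrow> ('a, 'v, 's) module_scheme \<Rightarrow> ('a, 'w, 't) module_scheme \<Rightarrow> ('v \<Rightarrow> 'w) set"
  where "linear_maps R V W = {f \<in> carrier V \<rightarrow> carrier W.
    (\<forall>x\<in>carrier V. \<forall>y\<in>carrier V. f (x \<oplus>\<^bsub>V\<^esub> y) = f x \<oplus>\<^bsub>W\<^esub> f y) \<and>
    (\<forall>a\<in>carrier R. \<forall>x\<in>carrier V. f (a \<odot>\<^bsub>V\<^esub> x) = a \<odot>\<^bsub>W\<^esub> f x)}"

definition finite_basis ::
  "('a, 'r) ring_scheme \<Rightarrow> ('a, 'v, 's) module_scheme \<Rightarrow> 'v set \<Rightarrow> bool"
  where "finite_basis R V B \<longleftrightarrow> finite B \<and> B \<subseteq> carrier V \<and>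
    (\<forall>x\<in>carrier V. \<exists>c\<in>B \<rightarrow> carrier R. x = (\<Oplus>\<^bsub>V\<^esub>b\<in>B. c b \<odot>\<^bsub>V\<^esub> b)) \<and>
    (\<forall>c\<in>B \<rightarrow> carrier R. (\<Oplus>\<^bsub>V\<^esub>b\<in>B. c b \<odot>\<^bsub>V\<^esub> b) = \<zero>\<^bsub>V\<^esub> \<longrightarrow> (\<forall>b\<in>B. c b = \<zero>\<^bsub>R\<^esub>))"

definition finite_free_module ::
  "('a, 'r) ring_scheme \<Rightarrow> ('a, 'v, 's) module_scheme \<Rightarrow> bool"
  where "finite_free_module R V \<longleftrightarrow> module R V \<and> (\<exists>B. finite_basis R V B)"

section \<open>The category of splittable injections\<close>

definition splittable_injections ::
  "('a, 'r) ring_scheme \<Rightarrow> ('a, 'v, 's) module_scheme \<Rightarrow> ('a, 'w, 't) module_scheme \<Rightarrow> ('v \<Rightarrow> 'w) set"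
  where "splittable_injections R V W = {f \<in> linear_maps R V W. inj_on f (carrier V) \<and>
    (\<exists>g\<in>linear_maps R W V. \<forall>x\<in>carrier V. g (f x) = x)}"

text \<open>
  The objects are the free \<open>R\<close>-modules of finite rank whose elements are drawn from the type
  \<open>'v\<close>. Up to isomorphism these are all free \<open>R\<close>-modules of finite rank as soon as \<open>'v\<close> is
  infinite and \<open>R\<close> is finite. Module records have \<open>mult\<close> and \<open>one\<close> fields without meaning
  for modules; records differing only there are distinct but isomorphic objects.
  Arrows are taken extensional so that a map on the carrier is represented by exactly one
  HOL function.
\<close>

definition VI :: "('a, 'r) ring_scheme \<Rightarrow> (('a, 'v) module, 'v \<Rightarrow> 'v) category_data"
  where "VI R = \<lparr>
    Obj = {V. finite_free_module R V},
    Hom = (\<lambda>V W. splittable_injections R V W \<inter> extensional (carrier V)),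
    Ident = (\<lambda>V. \<lambda>x\<in>carrier V. x),
    Comp = (\<lambda>U V W g f. compose (carrier U) g f)\<rparr>"

lemma linear_maps_comp:
  assumes "f \<in> linear_maps R U V" "g \<in> linear_maps R V W" "module R U"
  shows "compose (carrier U) g f \<in> linear_maps R U W"
proof -
  interpret U: module R U by fact
  show ?thesis using assms unfolding linear_maps_def compose_def by (auto simp: Pi_iff)
qed

lemma splittable_injections_comp:
  assumes "module R U" "module R W"
    and f: "f \<in> splittable_injections R U V" and g: "g \<in> splittable_injections R V W"
  shows "compose (carrier U) g f \<in> splittable_injections R U W"
proof -
  obtain f' where f': "f' \<in> linear_maps R V U" "\<And>x. x \<in> carrier U \<Longrightarrow> f' (f x) = x"
    using f unfolding splittable_injections_def by auto
  obtain g' where g': "g' \<in> linear_maps R W V" "\<And>x. x \<in> carrier V \<Longrightarrow> g' (g x) = x"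
    using g unfolding splittable_injections_def by auto
  have fl: "f \<in> linear_maps R U V" and gl: "g \<in> linear_maps R V W"
    using f g unfolding splittable_injections_def by auto
  have fc: "f x \<in> carrier V" if "x \<in> carrier U" for x
    using fl that unfolding linear_maps_def by auto
  have gc: "g x \<in> carrier W" if "x \<in> carrier V" for x
    using gl that unfolding linear_maps_def by auto
  let ?h = "compose (carrier U) g f" and ?h' = "compose (carrier W) f' g'"
  have left_inv: "?h' (?h x) = x" if "x \<in> carrier U" for x
    using that by (simp add: compose_eq fc gc f'(2) g'(2))
  then have "inj_on ?h (carrier U)" by (rule inj_on_inverseI)
  moreover have "?h \<in> linear_maps R U W" using fl gl assms(1) by (rule linear_maps_comp)
  moreover have "?h' \<in> linear_maps R W U" using g'(1) f'(1) assms(2) by (rule linear_maps_comp)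
  ultimately show ?thesis using left_inv unfolding splittable_injections_def by blast
qed

lemma category_VI: "category (VI R :: (('a, 'v) module, 'v \<Rightarrow> 'v) category_data)"
proof
  fix V :: "('a, 'v) module" assume "V \<in> Obj (VI R)"
  then have "module R V" by (simp add: VI_def finite_free_module_def)
  then interpret module R V .
  have "(\<lambda>x\<in>carrier V. x) \<in> linear_maps R V V" unfolding linear_maps_def by auto
  then have "(\<lambda>x\<in>carrier V. x) \<in> splittable_injections R V V"
    unfolding splittable_injections_def
    by (auto simp: inj_on_def intro!: bexI[of _ "\<lambda>x\<in>carrier V. x"])
  then show "Ident (VI R) V \<in> Hom (VI R) V V" by (simp add: VI_def)
next
  fix U V W :: "('a, 'v) module" and f g
  assume "U \<in> Obj (VI R)" "V \<in> Obj (VI R)" "W \<in> Obj (VI R)"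
    "f \<in> Hom (VI R) U V" "g \<in> Hom (VI R) V W"
  then show "Comp (VI R) U V W g f \<in> Hom (VI R) U W"
    by (auto simp: VI_def finite_free_module_def intro: splittable_injections_comp)
next
  fix U V :: "('a, 'v) module" and f
  assume "f \<in> Hom (VI R) U V"
  then show "Comp (VI R) U V V (Ident (VI R) V) f = f" "Comp (VI R) U U V f (Ident (VI R) U) = f"
    by (auto simp: VI_def splittable_injections_def linear_maps_def compose_def
        intro!: extensionalityI[of _ "carrier U"])
next
  fix T U V W :: "('a, 'v) module" and f g h
  assume "f \<in> Hom (VI R) T U"
  then show "Comp (VI R) T U W (Comp (VI R) U V W h g) f
      = Comp (VI R) T V W h (Comp (VI R) T U V g f)"
    by (auto simp: VI_def splittable_injections_def linear_maps_def compose_def fun_eq_iff)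
qed

section \<open>Modules over a category\<close>

record ('o, 'm, 'k, 'w) cat_module_data =
  val :: "'o \<Rightarrow> ('k, 'w) module"
  act :: "'o \<Rightarrow> 'o \<Rightarrow> 'm \<Rightarrow> 'w \<Rightarrow> 'w"

text \<open>
  A functor to \<open>k\<close>-modules. The linear map \<open>act M x y f\<close> from \<open>val M x\<close> to \<open>val M y\<close> only
  matters on the carrier of \<open>val M x\<close>.
\<close>

locale cat_module =
  fixes C :: "('o, 'm) category_data" and k :: "('k, 's) ring_scheme"
    and M :: "('o, 'm, 'k, 'w) cat_module_data"
  assumes val_module: "x \<in> Obj C \<Longrightarrow> module k (val M x)"
    and act_linear: "\<lbrakk>x \<in> Obj C; y \<in> Obj C; f \<in> Hom C x y\<rbrakk>
      \<Longrightarrow> act M x y f \<in> linear_maps k (val M x) (val M y)"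
    and act_ident: "\<lbrakk>x \<in> Obj C; v \<in> carrier (val M x)\<rbrakk> \<Longrightarrow> act M x x (Ident C x) v = v"
    and act_comp: "\<lbrakk>x \<in> Obj C; y \<in> Obj C; z \<in> Obj C; f \<in> Hom C x y; g \<in> Hom C y z;
        v \<in> carrier (val M x)\<rbrakk>
      \<Longrightarrow> act M x z (Comp C x y z g f) v = act M y z g (act M x y f v)"

definition cat_submodule ::
  "('o, 'm) category_data \<Rightarrow> ('k, 's) ring_scheme \<Rightarrow> ('o, 'm, 'k, 'w) cat_module_data
    \<Rightarrow> ('o \<Rightarrow> 'w set) \<Rightarrow> bool"
  where "cat_submodule C k M N \<longleftrightarrow>
    (\<forall>x\<in>Obj C. submodule (N x) k (val M x)) \<and>
    (\<forall>x\<in>Obj C. \<forall>y\<in>Obj C. \<forall>f\<in>Hom C x y. act M x y f ` N x \<subseteq> N y)"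

definition restrict_module ::
  "('o, 'm, 'k, 'w) cat_module_data \<Rightarrow> ('o \<Rightarrow> 'w set) \<Rightarrow> ('o, 'm, 'k, 'w) cat_module_data"
  where "restrict_module M N = M\<lparr>val := \<lambda>x. (val M x)\<lparr>carrier := N x\<rparr>\<rparr>"

lemma (in cat_module) cat_module_restrict_module:
  assumes "cat_submodule C k M N"
  shows "cat_module C k (restrict_module M N)"
proof (rule cat_module.intro)
  fix x assume x: "x \<in> Obj C"
  then show "module k (val (restrict_module M N) x)"
    using assms val_module submodule.submodule_is_module
    unfolding cat_submodule_def restrict_module_def by fastforce
next
  fix x y f assume xy: "x \<in> Obj C" "y \<in> Obj C" and f: "f \<in> Hom C x y"
  have "N x \<subseteq> carrier (val M x)"
    using assms xy module.submoduleE(1) val_module unfolding cat_submodule_def by fast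
  moreover have "act M x y f ` N x \<subseteq> N y"
    using assms xy f unfolding cat_submodule_def by blast
  ultimately show "act (restrict_module M N) x y f
      \<in> linear_maps k (val (restrict_module M N) x) (val (restrict_module M N) y)"
    using act_linear[OF xy f] unfolding linear_maps_def restrict_module_def
    by (auto simp: subset_iff)
next
  fix x v assume "x \<in> Obj C" "v \<in> carrier (val (restrict_module M N) x)"
  moreover from this have "v \<in> carrier (val M x)"
    using assms module.submoduleE(1) val_module
    unfolding cat_submodule_def restrict_module_def by fastforce
  ultimately show "act (restrict_module M N) x x (Ident C x) v = v"
    by (simp add: restrict_module_def act_ident)
next
  fix x y z f g v
  assume *: "x \<in> Obj C" "y \<in> Obj C" "z \<in> Obj C" "f \<in> Hom C x y" "g \<in> Hom C y z"
    and "v \<in> carrier (val (restrict_module M N) x)"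
  then have "v \<in> carrier (val M x)"
    using assms module.submoduleE(1) val_module
    unfolding cat_submodule_def restrict_module_def by fastforce
  with * show "act (restrict_module M N) x z (Comp C x y z g f) v
      = act (restrict_module M N) y z g (act (restrict_module M N) x y f v)"
    by (simp add: restrict_module_def act_comp)
qed

text \<open>The smallest submodule containing the elements \<open>v\<close> of \<open>val M x\<close> for all \<open>(x, v)\<close> in \<open>X\<close>.\<close>

definition cat_span ::
  "('o, 'm) category_data \<Rightarrow> ('k, 's) ring_scheme \<Rightarrow> ('o, 'm, 'k, 'w) cat_module_data
    \<Rightarrow> ('o \<times> 'w) set \<Rightarrow> 'o \<Rightarrow> 'w set"
  where "cat_span C k M X x =
    \<Inter> {N x | N. cat_submodule C k M N \<and> (\<forall>(y, v)\<in>X. v \<in> N y)}"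

lemma (in cat_module) cat_submodule_carrier: "cat_submodule C k M (\<lambda>x. carrier (val M x))"
  unfolding cat_submodule_def
proof (intro conjI ballI)
  fix x assume "x \<in> Obj C"
  then show "submodule (carrier (val M x)) k (val M x)"
    by (intro module.carrier_is_submodule val_module)
next
  fix x y f assume "x \<in> Obj C" "y \<in> Obj C" "f \<in> Hom C x y"
  then show "act M x y f ` carrier (val M x) \<subseteq> carrier (val M y)"
    using act_linear unfolding linear_maps_def by blast
qed

lemma (in cat_module) cat_submodule_cat_span:
  assumes "X \<subseteq> (SIGMA x:Obj C. carrier (val M x))"
  shows "cat_submodule C k M (cat_span C k M X)"
  unfolding cat_submodule_def
proof (intro conjI ballI)
  fix x assume x: "x \<in> Obj C"
  interpret V: module k "val M x" using x by (rule val_module)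
  have sub: "submodule (N x) k (val M x)" if "cat_submodule C k M N" for N
    using that x unfolding cat_submodule_def by blast
  have mem: "v \<in> cat_span C k M X x \<longleftrightarrow>
      (\<forall>N. cat_submodule C k M N \<longrightarrow> (\<forall>(y, w)\<in>X. w \<in> N y) \<longrightarrow> v \<in> N x)" for v
    unfolding cat_span_def by blast
  have zero: "\<zero>\<^bsub>val M x\<^esub> \<in> N x" if "cat_submodule C k M N" for N
    using subgroup.one_closed[OF submodule.axioms(1)[OF sub[OF that]]] by simp
  show "submodule (cat_span C k M X x) k (val M x)"
  proof (rule V.submoduleI)
    show "cat_span C k M X x \<subseteq> carrier (val M x)"
    proof
      fix v assume "v \<in> cat_span C k M X x"
      moreover have "\<forall>(y, w)\<in>X. w \<in> carrier (val M y)" using assms by auto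
      ultimately show "v \<in> carrier (val M x)" using cat_submodule_carrier
        mem[THEN iffD1, rule_format, where N = "\<lambda>x. carrier (val M x)"] by blast
    qed
  qed (simp_all add: mem zero V.submoduleE(3-5)[OF sub])
next
  fix x y f assume "x \<in> Obj C" "y \<in> Obj C" "f \<in> Hom C x y"
  then have stable: "act M x y f v \<in> N y" if "cat_submodule C k M N" "v \<in> N x" for N v
    using that unfolding cat_submodule_def by blast
  show "act M x y f ` cat_span C k M X x \<subseteq> cat_span C k M X y"
  proof (intro image_subsetI)
    fix v assume v: "v \<in> cat_span C k M X x"
    show "act M x y f v \<in> cat_span C k M X y"
      unfolding cat_span_def
    proof (intro InterI, elim CollectE exE conjE)
      fix S N
      assume S: "S = N y" and N: "cat_submodule C k M N" "\<forall>(y, w)\<in>X. w \<in> N y"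
      have "v \<in> N x" using v N unfolding cat_span_def by auto
      then show "act M x y f v \<in> S" using stable N(1) S by simp
    qed
  qed
qed

definition finitely_generated ::
  "('o, 'm) category_data \<Rightarrow> ('k, 's) ring_scheme \<Rightarrow> ('o, 'm, 'k, 'w) cat_module_data \<Rightarrow> bool"
  where "finitely_generated C k M \<longleftrightarrow>
    (\<exists>X. finite X \<and> X \<subseteq> (SIGMA x:Obj C. carrier (val M x)) \<and>
      (\<forall>x\<in>Obj C. cat_span C k M X x = carrier (val M x)))"

text \<open>
  The type argument is the universe from which the elements of the \<open>k\<close>-modules are drawn.
\<close>

definition locally_noetherian ::
  "'w itself \<Rightarrow> ('o, 'm) category_data \<Rightarrow> ('k, 's) ring_scheme \<Rightarrow> bool"
  where "locally_noetherian _ C k \<longleftrightarrow>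
    (\<forall>M :: ('o, 'm, 'k, 'w) cat_module_data. cat_module C k M \<and> finitely_generated C k M \<longrightarrow>
      (\<forall>N. cat_submodule C k M N \<longrightarrow> finitely_generated C k (restrict_module M N)))"

end

theory Submission
  imports Defs "HOL-Library.Ramsey"
begin

text \<open>
  A linear map from \<open>V\<close> to \<open>R\<^sup>n\<close> is a word of length \<open>n\<close> over the set of functionals on \<open>V\<close>, and that
  alphabet is finite since \<open>R\<close> is. A surjection \<open>g\<close> from \<open>{..<m}\<close> onto \<open>{..<n}\<close> induces a splittable
  injection from \<open>R\<^sup>n\<close> to \<open>R\<^sup>m\<close>, and composition with it precomposes words with \<open>g\<close>. So if \<open>M\<close> is a
  module over the category of splittable injections, generated by elements \<open>x\<^sub>i\<close> at objects \<open>V\<^sub>i\<close>,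
  its value at \<open>R\<^sup>n\<close> is generated by elements \<open>e (i, w)\<close>, the images of \<open>x\<^sub>i\<close> under the arrows
  given by words \<open>w\<close> of length \<open>n\<close>, and \<open>g\<close> acts by \<open>e (i, w) \<mapsto> e (i, w \<circ> g)\<close>. Restriction
  along \<open>S \<mapsto> R\<^sup>S\<close> thus turns \<open>M\<close> into a module over the opposite of the category of finite sets and
  surjections, and this module is finitely generated as well: every word arises by some \<open>g\<close> from a
  word without repeated letters, and there are finitely many of those. Every object is isomorphic to some \<open>R\<^sup>n\<close>, so submodules may be
  compared after this restriction (\<open>cat_submodule_VI_subset_transfer\<close>).

  What remains is the Noetherian property for surjections, which follows the Groebner basis argument
  of Sam and Snowden. It uses only those surjections that are ordered, in the sense that the last
  preimages of \<open>0\<close>, \<open>1\<close>, \<open>2\<close>, \<open>\<dots>\<close> come in this order, and it needs two facts about them. They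
  preserve a linear order on the words of each length (\<open>word_rank_ordered_surj_mono\<close>), hence they
  preserve leading terms. And the relation that some ordered surjection leads from one word to
  another has no infinite bad sequence (\<open>inflates_wqo\<close>), which is a variant of Higman's lemma and
  takes the place of Dickson's lemma in Hilbert's basis theorem. Together with the ascending chain
  condition in \<open>k\<close> the second fact bounds the leading terms of a submodule by finitely many
  (\<open>finite_generating_coefficients\<close>), and division with remainder shows that finitely many elements
  with these leading terms generate it (\<open>finitely_determined\<close>).
\<close>

section \<open>A well-quasi-order on words over a finite alphabet\<close>

text \<open>
  Reading \<open>xs\<close> as a map from positions to letters, \<open>inflates xs ys\<close> says that \<open>ys\<close> is \<open>xs\<close> precomposed
  with a surjection of positions under which the last preimages of the positions come in increasing
  order. On lists this means that \<open>ys\<close> arises from \<open>xs\<close> by inserting letters, each of which occurs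
  again further right. Looking at last rather than first preimages makes the head of a list the
  place where such a surjection is built up.
\<close>

inductive inflates :: "'l list \<Rightarrow> 'l list \<Rightarrow> bool" where
  Nil: "inflates [] []"
| Cons: "inflates xs ys \<Longrightarrow> inflates (a # xs) (a # ys)"
| Repeat: "inflates xs ys \<Longrightarrow> a \<in> set xs \<Longrightarrow> inflates xs (a # ys)"

lemma set_inflates: "inflates xs ys \<Longrightarrow> set ys = set xs"
  by (induction rule: inflates.induct) auto

lemma infinite_constant_on:
  fixes f :: "nat \<Rightarrow> 'c"
  assumes "infinite K" "finite C" "f ` K \<subseteq> C"
  obtains L c where "infinite L" "L \<subseteq> K" "\<And>n. n \<in> L \<Longrightarrow> f n = c"
proof -
  have "finite (f ` K)" using assms(2,3) by (rule rev_finite_subset)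
  from pigeonhole_infinite[OF assms(1) this]
  obtain a where a: "a \<in> K" "infinite {n \<in> K. f n = f a}" by blast
  then show ?thesis using assms(3) by (intro that[of "{n \<in> K. f n = f a}" "f a"]) auto
qed

definition bad_sequence :: "'l set \<Rightarrow> (nat \<Rightarrow> 'l list) \<Rightarrow> bool"
  where "bad_sequence S f \<longleftrightarrow>
    (\<forall>n. set (f n) \<subseteq> S) \<and> (\<forall>i j. i < j \<longrightarrow> \<not> inflates (f i) (f j))"

text \<open>
  The construction of Nash-Williams: among the bad sequences that continue the entries chosen so
  far, choose one whose next entry is shortest. The choices agree on longer and longer initial
  segments, so their diagonal is bad as well, and no bad sequence that agrees with it up to some
  index has a shorter entry there.
\<close>

lemma minimal_bad_sequence:
  assumes "bad_sequence S f0"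
  obtains m where "bad_sequence S m"
    and "\<And>h n. \<lbrakk>bad_sequence S h; \<And>i. i < n \<Longrightarrow> h i = m i\<rbrakk> \<Longrightarrow> length (m n) \<le> length (h n)"
proof -
  define A where "A n f = {h. bad_sequence S h \<and> (\<forall>i<n. h i = f i)}" for n and f :: "nat \<Rightarrow> 'a list"
  have min: "\<exists>g. g \<in> A n f \<and> (\<forall>h\<in>A n f. length (g n) \<le> length (h n))"
    if "bad_sequence S f" for n f
    using that ex_has_least_nat[of "\<lambda>h. h \<in> A n f" f "\<lambda>h. length (h n)"] by (auto simp: A_def)
  have "\<exists>F. \<forall>n. (bad_sequence S (F n) \<and> (\<forall>h\<in>A n (F n). length (F n n) \<le> length (h n))) \<and>
      (\<forall>i\<le>n. F (Suc n) i = F n i)"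
  proof (rule dependent_nat_choice)
    show "\<exists>g. bad_sequence S g \<and> (\<forall>h\<in>A 0 g. length (g 0) \<le> length (h 0))"
      using min[OF assms, of 0] by (auto simp: A_def)
  next
    fix f n
    assume "bad_sequence S f \<and> (\<forall>h\<in>A n f. length (f n) \<le> length (h n))"
    then obtain g where "g \<in> A (Suc n) f"
      "\<And>h. h \<in> A (Suc n) f \<Longrightarrow> length (g (Suc n)) \<le> length (h (Suc n))"
      using min[of f "Suc n"] by blast
    moreover from this have "A (Suc n) g = A (Suc n) f" by (auto simp: A_def)
    ultimately show "\<exists>g. (bad_sequence S g \<and>
        (\<forall>h\<in>A (Suc n) g. length (g (Suc n)) \<le> length (h (Suc n)))) \<and> (\<forall>i\<le>n. g i = f i)"
      by (intro exI[of _ g]) (auto simp: A_def)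
  qed
  then obtain F where bad: "bad_sequence S (F n)"
    and least: "h \<in> A n (F n) \<Longrightarrow> length (F n n) \<le> length (h n)"
    and step: "i \<le> n \<Longrightarrow> F (Suc n) i = F n i" for n h i by metis
  have F: "F n i = F i i" if "i \<le> n" for n i
    using that by (induction rule: dec_induct) (auto simp: step)
  show ?thesis
  proof
    show "bad_sequence S (\<lambda>n. F n n)"
      unfolding bad_sequence_def
    proof (intro conjI allI impI)
      fix i j :: nat assume "i < j"
      then have "F i i = F j i" using F[of i j] by simp
      then show "\<not> inflates (F i i) (F j j)"
        using bad[of j] \<open>i < j\<close> unfolding bad_sequence_def by simp
    qed (use bad in \<open>auto simp: bad_sequence_def\<close>)
  next
    fix h n assume h: "bad_sequence S h" "\<And>i. i < n \<Longrightarrow> h i = F i i"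
    have "h i = F n i" if "i < n" for i using h(2)[OF that] F[of i n] that by simp
    then have "h \<in> A n (F n)" using h(1) by (simp add: A_def)
    then show "length (F n n) \<le> length (h n)" by (rule least)
  qed
qed

text \<open>
  This is Higman's lemma for a relation that is stronger than the subword order, and finiteness of
  the alphabet is essential. Infinitely many entries of a minimal bad sequence have the same head \<open>x\<close>,
  and their tails form a bad sequence because a common head can be put back. If \<open>x\<close> is absent
  from these tails, they are words over a smaller alphabet, which the induction on the alphabet
  excludes. If \<open>x\<close> occurs in them, then an earlier entry below such a tail also contains \<open>x\<close>
  and is thus below the whole word, so replacing the words by their tails keeps the sequence bad,
  against minimality.
\<close>

lemma inflates_wqo:
  assumes "finite S" "\<And>n::nat. set (f n) \<subseteq> S"
  shows "\<exists>i j. i < j \<and> inflates (f i) (f j)"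
  using assms
proof (induction S arbitrary: f rule: finite_psubset_induct)
  case (psubset S)
  show ?case
  proof (rule ccontr)
    assume "\<not> ?thesis"
    then have "bad_sequence S f" using psubset.prems by (auto simp: bad_sequence_def)
    then obtain m where m: "bad_sequence S m"
      and least: "\<And>h n. \<lbrakk>bad_sequence S h; \<And>i. i < n \<Longrightarrow> h i = m i\<rbrakk> \<Longrightarrow> length (m n) \<le> length (h n)"
      using minimal_bad_sequence by blast
    have letters: "set (m n) \<subseteq> S" and bad: "i < j \<Longrightarrow> \<not> inflates (m i) (m j)" for n i j
      using m by (auto simp: bad_sequence_def)
    have inf: "infinite {n. m n \<noteq> []}"
    proof
      assume fin: "finite {n. m n \<noteq> []}"
      then have inf: "infinite {n. m n = []}"
        using finite_Collect_not[of "\<lambda>n. m n \<noteq> []"] by simp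
      then obtain i where i: "m i = []" using not_finite_existsD by blast
      obtain j where "j > i" "m j = []" using inf unfolding infinite_nat_iff_unbounded by blast
      then show False using bad[of i j] i by (simp add: inflates.Nil)
    qed
    have colours: "(\<lambda>n. (hd (m n), hd (m n) \<in> set (tl (m n)))) ` {n. m n \<noteq> []} \<subseteq> S \<times> UNIV"
      using letters by (auto intro: subsetD[OF letters] hd_in_set)
    have fin: "finite (S \<times> (UNIV :: bool set))" using psubset.hyps by simp
    obtain L c where L: "infinite L" "L \<subseteq> {n. m n \<noteq> []}"
      and "\<And>n. n \<in> L \<Longrightarrow> (hd (m n), hd (m n) \<in> set (tl (m n))) = c"
      by (rule infinite_constant_on[OF inf fin colours]) (rule that)
    then obtain x r where head: "\<And>n. n \<in> L \<Longrightarrow> hd (m n) = x"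
      and rep: "\<And>n. n \<in> L \<Longrightarrow> (x \<in> set (tl (m n))) = r"
      by (cases c) (metis prod.inject)
    define l where "l = enumerate L"
    have l: "l n \<in> L" "i < j \<Longrightarrow> l i < l j" for n i j
      using L(1) by (auto simp: l_def enumerate_in_set)
    have m_l: "m (l n) = x # tl (m (l n))" for n
    proof -
      have "m (l n) \<noteq> []" using l(1)[of n] L(2) by blast
      then show ?thesis using head[OF l(1)[of n]] by (cases "m (l n)") auto
    qed
    have tails_bad: "\<not> inflates (tl (m (l i))) (tl (m (l j)))" if "i < j" for i j
    proof
      assume "inflates (tl (m (l i))) (tl (m (l j)))"
      then have "inflates (x # tl (m (l i))) (x # tl (m (l j)))" by (rule inflates.Cons)
      then show False using bad[OF l(2)[OF that]] by (simp only: m_l[symmetric])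
    qed
    have tail_letters: "set (tl (m (l n))) \<subseteq> S" for n
      using letters[of "l n"] arg_cong[OF m_l[of n], of set] by auto
    show False
    proof (cases r)
      case False
      have "x \<in> S" using letters[of "l 0"] arg_cong[OF m_l[of 0], of set] by auto
      moreover have "set (tl (m (l n))) \<subseteq> S - {x}" for n
        using tail_letters[of n] rep[OF l(1)[of n]] False by auto
      ultimately show False
        using psubset.IH[of "S - {x}" "\<lambda>n. tl (m (l n))"] tails_bad by blast
    next
      case True
      define h where "h i = (if i < l 0 then m i else tl (m (l (i - l 0))))" for i
      have "bad_sequence S h"
        unfolding bad_sequence_def
      proof (intro conjI allI impI)
        fix n show "set (h n) \<subseteq> S" using letters tail_letters by (simp add: h_def)
      next
        fix i j :: nat assume "i < j"
        consider "j < l 0" | "i < l 0" "l 0 \<le> j" | "l 0 \<le> i" by linarith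
        then show "\<not> inflates (h i) (h j)"
        proof cases
          case 1 then show ?thesis using bad \<open>i < j\<close> by (simp add: h_def)
        next
          case 2
          let ?j = "l (j - l 0)"
          have "i < ?j" using 2 l(2)[of 0 "j - l 0"] by (cases "j = l 0") auto
          show ?thesis
          proof
            \<comment> \<open>\<open>x\<close> occurs in the tail, hence in \<open>m i\<close>, so \<open>Repeat\<close> can put \<open>x\<close> back\<close>
            assume "inflates (h i) (h j)"
            then have *: "inflates (m i) (tl (m ?j))" using 2 by (simp add: h_def)
            moreover have "x \<in> set (m i)"
              using set_inflates[OF *] rep[OF l(1)[of "j - l 0"]] True by simp
            ultimately have "inflates (m i) (x # tl (m ?j))" by (rule inflates.Repeat)
            then show False using bad[OF \<open>i < ?j\<close>] by (simp only: m_l[symmetric])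
          qed
        next
          case 3
          then show ?thesis using tails_bad[of "i - l 0" "j - l 0"] \<open>i < j\<close> by (simp add: h_def)
        qed
      qed
      then have "length (m (l 0)) \<le> length (h (l 0))" by (rule least) (simp add: h_def)
      moreover have "length (h (l 0)) < length (m (l 0))"
        using arg_cong[OF m_l[of 0], of length] by (simp add: h_def)
      ultimately show False by simp
    qed
  qed
qed

definition almost_full_on :: "('t \<Rightarrow> 't \<Rightarrow> bool) \<Rightarrow> 't set \<Rightarrow> bool"
  where "almost_full_on emb S \<longleftrightarrow>
    (\<forall>f :: nat \<Rightarrow> 't. range f \<subseteq> S \<longrightarrow> (\<exists>i j. i < j \<and> emb (f i) (f j)))"

text \<open>
  By Ramsey's theorem, applied to the colouring of the pairs \<open>i < j\<close> by whether the \<open>i\<close>-th entry is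
  below the \<open>j\<close>-th: a homogeneous subsequence of the other colour would contradict almost-fullness.
\<close>

lemma almost_full_on_subsequence:
  assumes wqo: "almost_full_on emb S"
    and f: "range f \<subseteq> S"
  shows "\<exists>l :: nat \<Rightarrow> nat. strict_mono l \<and> (\<forall>i j. i < j \<longrightarrow> emb (f (l i)) (f (l j)))"
proof -
  define col where "col X = (if emb (f (Min X)) (f (Max X)) then 1 else 0 :: nat)" for X
  have "\<forall>i\<in>UNIV. \<forall>j\<in>UNIV. i \<noteq> j \<longrightarrow> col {i, j} < 2" by (simp add: col_def)
  from Ramsey2[OF infinite_UNIV_nat this]
  obtain Y t where Y: "infinite Y" and t: "\<forall>i\<in>Y. \<forall>j\<in>Y. i \<noteq> j \<longrightarrow> col {i, j} = t"
    by (elim exE conjE)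
  define l where "l = enumerate Y"
  have l: "strict_mono l" "l n \<in> Y" for n
    using Y by (auto simp: l_def strict_mono_enumerate enumerate_in_set)
  have col: "emb (f (l i)) (f (l j)) \<longleftrightarrow> t = 1" if "i < j" for i j
  proof -
    have "l i < l j" using l(1) that by (simp add: strict_monoD)
    then have "col {l i, l j} = t" using t l(2) by simp
    then have "t = (if emb (f (l i)) (f (l j)) then 1 else 0)"
      using \<open>l i < l j\<close> by (simp add: col_def)
    then show ?thesis by (cases "emb (f (l i)) (f (l j))") simp_all
  qed
  have "range (\<lambda>n. f (l n)) \<subseteq> S" using f by blast
  from wqo[unfolded almost_full_on_def, rule_format, OF this]
  obtain i j where "i < j" "emb (f (l i)) (f (l j))" by (elim exE conjE)
  then have "t = 1" using col[of i j] by simp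
  have "emb (f (l i)) (f (l j))" if "i < j" for i j
    using col[OF that] \<open>t = 1\<close> by blast
  with l(1) show ?thesis by blast
qed

text \<open>
  With finitely many indices, a sequence of indexed words has a subsequence with constant index.
\<close>

lemma almost_full_on_indexed_words:
  fixes A :: "'l set"
  assumes A: "finite A"
  shows "almost_full_on (\<lambda>(i, w) (j, u). i = j \<and> inflates w u) {(i, w). i < (r :: nat) \<and> set w \<subseteq> A}"
  unfolding almost_full_on_def
proof (intro allI impI)
  fix f :: "nat \<Rightarrow> nat \<times> 'l list"
  assume f: "range f \<subseteq> {(i, w). i < r \<and> set w \<subseteq> A}"
  have f_D: "fst (f n) < r" "set (snd (f n)) \<subseteq> A" for n
    using subsetD[OF f rangeI[of f n]] by (auto simp: case_prod_unfold)
  have "(\<lambda>n. fst (f n)) ` UNIV \<subseteq> {..<r}" using f_D(1) by auto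
  then obtain L c where L: "infinite L" "L \<subseteq> UNIV" "\<And>n. n \<in> L \<Longrightarrow> fst (f n) = c"
    by (rule infinite_constant_on[OF infinite_UNIV_nat finite_lessThan]) (rule that)
  obtain i j where ij: "i < j" "inflates (snd (f (enumerate L i))) (snd (f (enumerate L j)))"
    using inflates_wqo[OF A f_D(2)] by blast
  have "enumerate L i < enumerate L j" using L(1) ij(1) by simp
  moreover have "fst (f (enumerate L i)) = fst (f (enumerate L j))"
    using L by (simp add: enumerate_in_set)
  ultimately show "\<exists>i j. i < j \<and> (case f i of (i, w) \<Rightarrow> \<lambda>(j, u). i = j \<and> inflates w u) (f j)"
    using ij(2) by (intro exI[of _ "enumerate L i"] exI[of _ "enumerate L j"])
      (simp add: case_prod_unfold)
qed

section \<open>Ordered surjections and the order on words that they preserve\<close>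

text \<open>
  Lists \<open>g\<close> that represent surjections from \<open>{..<length g}\<close> onto \<open>{..<n}\<close> such that the last
  occurrences of \<open>0\<close>, \<dots>, \<open>n - 1\<close> in \<open>g\<close> come in this order.
\<close>

inductive ordered_surj :: "nat \<Rightarrow> nat list \<Rightarrow> bool" where
  Nil: "ordered_surj 0 []"
| Cons: "ordered_surj n g \<Longrightarrow> ordered_surj (Suc n) (0 # map Suc g)"
| Repeat: "ordered_surj n g \<Longrightarrow> t < n \<Longrightarrow> ordered_surj n (t # g)"

lemma set_ordered_surj: "ordered_surj n g \<Longrightarrow> set g = {..<n}"
  by (induction rule: ordered_surj.induct) (auto simp: lessThan_Suc_eq_insert_0)

text \<open>
  A section of \<open>g\<close> will split the injection that \<open>g\<close> induces on coordinates.
\<close>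

lemma ordered_surj_section:
  assumes "ordered_surj n g"
  obtains s where "length s = n" "set s \<subseteq> {..<length g}" "map ((!) g) s = [0..<n]"
proof -
  have "\<forall>i<n. \<exists>t<length g. g ! t = i"
    using set_ordered_surj[OF assms] by (metis in_set_conv_nth lessThan_iff)
  then obtain t where "\<And>i. i < n \<Longrightarrow> t i < length g \<and> g ! t i = i" by metis
  then show ?thesis by (intro that[of "map t [0..<n]"]) (auto intro!: nth_equalityI)
qed

lemma ordered_surj_upt: "ordered_surj n [0..<n]"
proof (induction n)
  case 0
  show ?case using ordered_surj.Nil by simp
next
  case (Suc n)
  have "[0..<Suc n] = 0 # map Suc [0..<n]" by (simp add: upt_conv_Cons map_Suc_upt del: upt_Suc)
  then show ?case using ordered_surj.Cons[OF Suc] by simp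
qed

lemma inflates_imp_ordered_surj:
  "inflates xs ys \<Longrightarrow> \<exists>g. ordered_surj (length xs) g \<and> ys = map ((!) xs) g"
proof (induction rule: inflates.induct)
  case Nil
  show ?case using ordered_surj.Nil by auto
next
  case (Cons xs ys a)
  then obtain g where "ordered_surj (length xs) g" "ys = map ((!) xs) g" by blast
  then show ?case using ordered_surj.Cons[of "length xs" g]
    by (intro exI[of _ "0 # map Suc g"]) auto
next
  case (Repeat xs ys a)
  then obtain g t where "ordered_surj (length xs) g" "ys = map ((!) xs) g" "t < length xs" "xs ! t = a"
    by (metis in_set_conv_nth)
  then show ?case using ordered_surj.Repeat[of "length xs" g t]
    by (intro exI[of _ "t # g"]) auto
qed

text \<open>
  For letters coded as digits below \<open>q\<close>, this is a number written in base \<open>q\<close> with the head as the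
  lowest digit and the index \<open>i\<close> above all digits. For words of one length, comparing ranks is
  comparing indices first and then the rightmost letters that differ.
\<close>

fun word_rank :: "nat \<Rightarrow> ('l \<Rightarrow> nat) \<Rightarrow> nat \<times> 'l list \<Rightarrow> nat" where
  "word_rank q d (i, []) = i"
| "word_rank q d (i, a # xs) = d a + q * word_rank q d (i, xs)"

lemma digit_less_iff:
  fixes a b q m n :: nat
  assumes "a < q" "b < q"
  shows "a + q * m < b + q * n \<longleftrightarrow> m < n \<or> (m = n \<and> a < b)"
proof -
  have *: "a + q * m < b + q * n" if "m < n" "a < q" for a b m n :: nat
  proof -
    have "a + q * m < q * Suc m" using that by simp
    also have "\<dots> \<le> q * n" using that by (intro mult_le_mono) auto
    finally show ?thesis by simp
  qed
  show ?thesis using *[of m n a b] *[of n m b a] assms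
    by (cases m n rule: linorder_cases) auto
qed

lemma word_rank_inj:
  assumes "length xs = length ys" "\<forall>a\<in>set xs \<union> set ys. d a < q" "inj_on d (set xs \<union> set ys)"
    and "word_rank q d (i, xs) = word_rank q d (j, ys)"
  shows "i = j \<and> xs = ys"
  using assms
proof (induction xs ys rule: list_induct2)
  case (Cons x xs y ys)
  have *: "word_rank q d (i, xs) = word_rank q d (j, ys) \<and> d x = d y"
    using Cons.prems digit_less_iff[of "d x" q "d y"] digit_less_iff[of "d y" q "d x"]
    by simp (metis less_irrefl_nat linorder_less_linear)
  moreover have "x = y" using * by (intro inj_onD[OF Cons.prems(2)]) auto
  moreover have "inj_on d (set xs \<union> set ys)"
    using Cons.prems(2) by (rule inj_on_subset) auto
  ultimately show ?case using Cons by auto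
qed auto

text \<open>
  Let \<open>p\<close> be the rightmost position where two words differ. After precomposition with \<open>g\<close> the
  rightmost difference is at the last occurrence of \<open>p\<close> in \<open>g\<close>: any value that occurs further right
  in \<open>g\<close> exceeds \<open>p\<close>, as last occurrences are ordered. So the same two letters decide. If the words
  are equal, the indices decide before and after.
\<close>

lemma word_rank_ordered_surj_mono:
  assumes "ordered_surj n g" "length xs = n" "length ys = n"
    and "\<forall>a\<in>set xs \<union> set ys. d a < q" "inj_on d (set xs \<union> set ys)"
    and "word_rank q d (i, xs) < word_rank q d (j, ys)"
  shows "word_rank q d (i, map ((!) xs) g) < word_rank q d (j, map ((!) ys) g)"
  using assms
proof (induction arbitrary: xs ys rule: ordered_surj.induct)
  case (Cons n g)
  then obtain a xs' b ys' where *: "xs = a # xs'" "ys = b # ys'" by (metis Suc_length_conv)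
  have inj: "inj_on d (set xs' \<union> set ys')"
    using Cons.prems(4) by (rule inj_on_subset) (auto simp: *)
  have "d a < q" "d b < q" using Cons.prems * by auto
  with Cons.prems(5) consider "word_rank q d (i, xs') < word_rank q d (j, ys')"
    | "word_rank q d (i, xs') = word_rank q d (j, ys')" "d a < d b"
    by (auto simp: * digit_less_iff)
  then show ?case
  proof cases
    case 1
    then have "word_rank q d (i, map ((!) xs') g) < word_rank q d (j, map ((!) ys') g)"
      using Cons.prems inj by (intro Cons.IH) (auto simp: *)
    then show ?thesis using \<open>d a < q\<close> \<open>d b < q\<close> by (simp add: * digit_less_iff comp_def)
  next
    case 2
    then have "i = j \<and> xs' = ys'" using Cons.prems inj by (intro word_rank_inj) (auto simp: *)
    then show ?thesis using \<open>d a < d b\<close> by (simp add: * comp_def)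
  qed
next
  case (Repeat n g t)
  then have "word_rank q d (i, map ((!) xs) g) < word_rank q d (j, map ((!) ys) g)" by blast
  moreover have "d (xs ! t) < q" "d (ys ! t) < q" using Repeat by auto
  ultimately show ?case by (simp add: digit_less_iff)
qed auto

section \<open>Coefficient ideals in a Noetherian ring\<close>

lemma (in cring) idealI_left:
  assumes "I \<subseteq> carrier R" "I \<noteq> {}"
    and add: "\<And>a b. \<lbrakk>a \<in> I; b \<in> I\<rbrakk> \<Longrightarrow> a \<oplus> b \<in> I"
    and mult: "\<And>a b. \<lbrakk>a \<in> carrier R; b \<in> I\<rbrakk> \<Longrightarrow> a \<otimes> b \<in> I"
  shows "ideal I R"
proof (rule idealI)
  show "subgroup I (add_monoid R)"
  proof (rule add.subgroupI)
    fix a assume "a \<in> I"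
    then have "\<ominus> a = \<ominus> \<one> \<otimes> a" using assms(1) by (auto simp: l_minus)
    then show "\<ominus> a \<in> I" using mult[of "\<ominus> \<one>" a] \<open>a \<in> I\<close> by simp
  qed (use assms in auto)
next
  fix a x assume "a \<in> I" "x \<in> carrier R"
  then show "x \<otimes> a \<in> I" by (simp add: mult)
  moreover have "a \<otimes> x = x \<otimes> a" using \<open>a \<in> I\<close> \<open>x \<in> carrier R\<close> assms(1) by (auto intro: m_comm)
  ultimately show "a \<otimes> x \<in> I" by simp
qed (rule ring_axioms)

lemma (in noetherian_ring) ex_in_genideal_of_earlier:
  fixes c :: "nat \<Rightarrow> 'a"
  assumes c: "range c \<subseteq> carrier R"
  shows "\<exists>n. c n \<in> Idl (c ` {..<n})"
proof -
  define C where "C = range (\<lambda>n. Idl (c ` {..<n}))"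
  have ideal: "ideal (Idl (c ` A)) R" for A using c by (intro genideal_ideal) auto
  have gen: "c ` A \<subseteq> Idl (c ` A)" for A using c by (intro genideal_self) auto
  have mono: "Idl (c ` A) \<subseteq> Idl (c ` B)" if "A \<subseteq> B" for A B
    using gen[of B] that by (intro genideal_minimal ideal) auto
  have "subset.chain {I. ideal I R} C"
    unfolding subset_chain_def C_def
  proof (intro conjI ballI)
    fix X Y assume "X \<in> range (\<lambda>n. Idl (c ` {..<n}))" "Y \<in> range (\<lambda>n. Idl (c ` {..<n}))"
    then obtain m n where "X = Idl (c ` {..<m})" "Y = Idl (c ` {..<n})" by blast
    then show "X \<subseteq> Y \<or> Y \<subseteq> X"
      using mono[of "{..<m}" "{..<n}"] mono[of "{..<n}" "{..<m}"] by (cases m n rule: le_cases) auto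
  qed (use ideal in auto)
  then have "\<Union>C \<in> C" by (intro ideal_chain_is_trivial) (auto simp: C_def)
  then obtain n where n: "\<Union>C = Idl (c ` {..<n})" by (auto simp: C_def)
  have "c n \<in> Idl (c ` {..<Suc n})" using gen[of "{..<Suc n}"] by auto
  also have "\<dots> \<subseteq> \<Union>C" by (auto simp: C_def)
  finally show ?thesis using n by auto
qed

text \<open>
  Each \<open>p\<close> in \<open>L\<close> carries a position \<open>ind p\<close> and a coefficient \<open>cf p\<close>. If no finite \<open>G\<close> generated, one
  could choose elements of \<open>L\<close> one after the other, each with a coefficient outside the ideal
  generated by the coefficients at earlier positions below its own. Along a subsequence with
  increasing positions, no coefficient would lie in the ideal generated by the earlier ones, which
  the ascending chain condition forbids.
\<close>

lemma (in noetherian_ring) finite_generating_coefficients: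
  fixes L :: "'p set" and ind :: "'p \<Rightarrow> 't" and cf :: "'p \<Rightarrow> 'a"
  assumes wqo: "almost_full_on emb T"
    and ind: "ind ` L \<subseteq> T" and cf: "cf ` L \<subseteq> carrier R"
  shows "\<exists>G\<subseteq>L. finite G \<and> (\<forall>p\<in>L. cf p \<in> Idl (cf ` {q \<in> G. emb (ind q) (ind p)}))"
proof (rule ccontr)
  assume none: "\<not> ?thesis"
  define new where "new G p \<longleftrightarrow> p \<in> L \<and> cf p \<notin> Idl (cf ` {q \<in> G. emb (ind q) (ind p)})" for G p
  have ex: "\<exists>p. new G p" if "finite G" "G \<subseteq> L" for G
    using none that unfolding new_def by blast
  have "\<exists>F. \<forall>n. (finite (fst (F n)) \<and> fst (F n) \<subseteq> L \<and> new (fst (F n)) (snd (F n))) \<and>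
      fst (F (Suc n)) = insert (snd (F n)) (fst (F n))"
  proof (rule dependent_nat_choice)
    show "\<exists>x. finite (fst x) \<and> fst x \<subseteq> L \<and> new (fst x) (snd x)" using ex[of "{}"] by auto
  next
    fix x :: "'p set \<times> 'p" and n :: nat
    assume x: "finite (fst x) \<and> fst x \<subseteq> L \<and> new (fst x) (snd x)"
    then obtain p where "new (insert (snd x) (fst x)) p"
      using ex[of "insert (snd x) (fst x)"] by (auto simp: new_def)
    then show "\<exists>y. (finite (fst y) \<and> fst y \<subseteq> L \<and> new (fst y) (snd y)) \<and>
        fst y = insert (snd x) (fst x)"
      using x by (intro exI[of _ "(insert (snd x) (fst x), p)"]) (auto simp: new_def)
  qed
  then obtain F where new: "fst (F n) \<subseteq> L" "new (fst (F n)) (snd (F n))"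
    and step: "fst (F (Suc n)) = insert (snd (F n)) (fst (F n))" for n by blast
  define p where "p n = snd (F n)" for n
  have p: "p n \<in> L" for n using new(2)[of n] by (simp add: new_def p_def)
  have earlier: "p i \<in> fst (F n)" if "i < n" for i n
    using that by (induction n) (auto simp: step p_def less_Suc_eq)
  have "range (\<lambda>n. ind (p n)) \<subseteq> T" using p ind by blast
  from almost_full_on_subsequence[OF wqo this]
  obtain l :: "nat \<Rightarrow> nat"
    where l: "strict_mono l" "\<forall>i j. i < j \<longrightarrow> emb (ind (p (l i))) (ind (p (l j)))"
    by (elim exE conjE)
  have "range (\<lambda>n. cf (p (l n))) \<subseteq> carrier R" using p cf by blast
  from ex_in_genideal_of_earlier[OF this]
  obtain n where n: "cf (p (l n)) \<in> Idl ((\<lambda>n. cf (p (l n))) ` {..<n})" by (elim exE)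
  let ?G = "{q \<in> fst (F (l n)). emb (ind q) (ind (p (l n)))}"
  have sub: "(\<lambda>n. cf (p (l n))) ` {..<n} \<subseteq> cf ` ?G"
    using earlier l by (auto simp: strict_mono_less)
  have G: "cf ` ?G \<subseteq> carrier R" using new(1) cf by blast
  have "Idl ((\<lambda>n. cf (p (l n))) ` {..<n}) \<subseteq> Idl (cf ` ?G)"
    using sub genideal_self[OF G] by (intro genideal_minimal genideal_ideal[OF G]) auto
  then have "cf (p (l n)) \<in> Idl (cf ` ?G)" using n by blast
  then show False using new(2)[of "l n"] by (simp add: new_def p_def)
qed

section \<open>Generated submodules and linear maps\<close>

definition generated_submodule ::
  "('k, 's) ring_scheme \<Rightarrow> ('k, 'w, 't) module_scheme \<Rightarrow> 'w set \<Rightarrow> 'w set"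
  where "generated_submodule k V S = \<Inter> {H. submodule H k V \<and> S \<subseteq> H}"

context module
begin

lemma generated_submodule_minimal:
  "\<lbrakk>submodule H R M; S \<subseteq> H\<rbrakk> \<Longrightarrow> generated_submodule R M S \<subseteq> H"
  by (auto simp: generated_submodule_def)

lemma generated_submodule_incl: "S \<subseteq> generated_submodule R M S"
  by (auto simp: generated_submodule_def)

lemma submodule_zero: "submodule H R M \<Longrightarrow> \<zero>\<^bsub>M\<^esub> \<in> H"
  using subgroup.one_closed[OF submodule.axioms(1)] by fastforce

lemma submodule_diff:
  "\<lbrakk>submodule H R M; x \<in> H; y \<in> H\<rbrakk> \<Longrightarrow> x \<ominus>\<^bsub>M\<^esub> y \<in> H"
  by (simp add: a_minus_def submoduleE)

lemma submodule_generated_submodule: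
  assumes "S \<subseteq> carrier M"
  shows "submodule (generated_submodule R M S) R M"
proof (rule submoduleI)
  show "generated_submodule R M S \<subseteq> carrier M"
    using assms carrier_is_submodule by (rule generated_submodule_minimal[rotated])
qed (auto simp: generated_submodule_def submodule_zero submoduleE)

text \<open>
  The sums of a multiple of \<open>a\<close> and an element of the submodule generated by \<open>S\<close> already form a
  submodule.
\<close>

lemma generated_submodule_insert:
  assumes a: "a \<in> carrier M" and S: "S \<subseteq> carrier M"
    and x: "x \<in> generated_submodule R M (insert a S)"
  shows "\<exists>c\<in>carrier R. x \<ominus>\<^bsub>M\<^esub> c \<odot>\<^bsub>M\<^esub> a \<in> generated_submodule R M S"
proof -
  let ?L = "generated_submodule R M S"
  let ?H = "{x \<in> carrier M. \<exists>c\<in>carrier R. \<exists>z\<in>?L. x = c \<odot>\<^bsub>M\<^esub> a \<oplus>\<^bsub>M\<^esub> z}"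
  have L: "submodule ?L R M" using S by (rule submodule_generated_submodule)
  have Lc: "z \<in> carrier M" if "z \<in> ?L" for z using submoduleE(1)[OF L] that by blast
  have "submodule ?H R M"
  proof (rule submoduleI)
    show "\<zero>\<^bsub>M\<^esub> \<in> ?H" using submodule_zero[OF L] a
      by (auto intro!: bexI[of _ "\<zero>"] bexI[of _ "\<zero>\<^bsub>M\<^esub>"])
  next
    fix x assume "x \<in> ?H"
    then obtain c z where *: "c \<in> carrier R" "z \<in> ?L" "x = c \<odot>\<^bsub>M\<^esub> a \<oplus>\<^bsub>M\<^esub> z" by blast
    then have "\<ominus>\<^bsub>M\<^esub> x = (\<ominus> c) \<odot>\<^bsub>M\<^esub> a \<oplus>\<^bsub>M\<^esub> (\<ominus>\<^bsub>M\<^esub> z)"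
      using a Lc by (simp add: smult_l_minus M.minus_add)
    then show "\<ominus>\<^bsub>M\<^esub> x \<in> ?H" using * a Lc submoduleE(3)[OF L] by (auto intro!: bexI)
  next
    fix x y assume "x \<in> ?H" "y \<in> ?H"
    then obtain c z d w where *: "c \<in> carrier R" "z \<in> ?L" "x = c \<odot>\<^bsub>M\<^esub> a \<oplus>\<^bsub>M\<^esub> z"
      "d \<in> carrier R" "w \<in> ?L" "y = d \<odot>\<^bsub>M\<^esub> a \<oplus>\<^bsub>M\<^esub> w" by blast
    then have "x \<oplus>\<^bsub>M\<^esub> y = (c \<oplus> d) \<odot>\<^bsub>M\<^esub> a \<oplus>\<^bsub>M\<^esub> (z \<oplus>\<^bsub>M\<^esub> w)"
      using a Lc by (simp add: smult_l_distr M.a_ac)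
    moreover have "z \<oplus>\<^bsub>M\<^esub> w \<in> ?L" using * submoduleE(5)[OF L] by blast
    ultimately show "x \<oplus>\<^bsub>M\<^esub> y \<in> ?H" using * a Lc by blast
  next
    fix b x assume b: "b \<in> carrier R" and "x \<in> ?H"
    then obtain c z where *: "c \<in> carrier R" "z \<in> ?L" "x = c \<odot>\<^bsub>M\<^esub> a \<oplus>\<^bsub>M\<^esub> z" by blast
    then have "b \<odot>\<^bsub>M\<^esub> x = (b \<otimes> c) \<odot>\<^bsub>M\<^esub> a \<oplus>\<^bsub>M\<^esub> (b \<odot>\<^bsub>M\<^esub> z)"
      using a Lc b by (simp add: smult_r_distr smult_assoc1)
    moreover have "b \<odot>\<^bsub>M\<^esub> z \<in> ?L" using * b submoduleE(4)[OF L] by blast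
    ultimately show "b \<odot>\<^bsub>M\<^esub> x \<in> ?H" using * a Lc b by blast
  qed auto
  moreover have "a \<in> ?H"
    using a submodule_zero[OF L] by (auto intro!: bexI[of _ \<one>] bexI[of _ "\<zero>\<^bsub>M\<^esub>"])
  moreover have "s \<in> ?H" if "s \<in> S" for s
    using that a S generated_submodule_incl[of S]
    by (auto intro!: bexI[of _ \<zero>] bexI[of _ s])
  ultimately have "generated_submodule R M (insert a S) \<subseteq> ?H"
    by (intro generated_submodule_minimal) auto
  then obtain c z where *: "c \<in> carrier R" "z \<in> ?L" "x = c \<odot>\<^bsub>M\<^esub> a \<oplus>\<^bsub>M\<^esub> z" using x by blast
  then have "x \<ominus>\<^bsub>M\<^esub> c \<odot>\<^bsub>M\<^esub> a = z"
    using a Lc by (simp add: a_minus_def M.a_ac M.r_neg M.r_neg1)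
  then show ?thesis using * by blast
qed

text \<open>
  If \<open>L\<close> is the span of the terms below the generator \<open>a\<close>, then \<open>x \<ominus> c \<odot> a \<in> L\<close> says that \<open>c\<close> is a
  leading coefficient of \<open>x\<close> at \<open>a\<close>. The next two lemmas are why leading coefficients form an ideal.
\<close>

lemma lead_coeff_add:
  assumes "submodule L R M" "a \<in> carrier M" "x \<in> carrier M" "y \<in> carrier M"
    "c \<in> carrier R" "d \<in> carrier R"
    and "x \<ominus>\<^bsub>M\<^esub> c \<odot>\<^bsub>M\<^esub> a \<in> L" "y \<ominus>\<^bsub>M\<^esub> d \<odot>\<^bsub>M\<^esub> a \<in> L"
  shows "(x \<oplus>\<^bsub>M\<^esub> y) \<ominus>\<^bsub>M\<^esub> (c \<oplus> d) \<odot>\<^bsub>M\<^esub> a \<in> L"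
proof -
  have "(x \<oplus>\<^bsub>M\<^esub> y) \<ominus>\<^bsub>M\<^esub> (c \<oplus> d) \<odot>\<^bsub>M\<^esub> a = (x \<ominus>\<^bsub>M\<^esub> c \<odot>\<^bsub>M\<^esub> a) \<oplus>\<^bsub>M\<^esub> (y \<ominus>\<^bsub>M\<^esub> d \<odot>\<^bsub>M\<^esub> a)"
    using assms by (simp add: a_minus_def smult_l_distr M.minus_add M.a_ac)
  then show ?thesis using submoduleE(5)[OF assms(1)] assms by simp
qed

lemma lead_coeff_smult:
  assumes "submodule L R M" "a \<in> carrier M" "x \<in> carrier M" "b \<in> carrier R" "c \<in> carrier R"
    and "x \<ominus>\<^bsub>M\<^esub> c \<odot>\<^bsub>M\<^esub> a \<in> L"
  shows "b \<odot>\<^bsub>M\<^esub> x \<ominus>\<^bsub>M\<^esub> (b \<otimes> c) \<odot>\<^bsub>M\<^esub> a \<in> L"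
proof -
  have "b \<odot>\<^bsub>M\<^esub> x \<ominus>\<^bsub>M\<^esub> (b \<otimes> c) \<odot>\<^bsub>M\<^esub> a = b \<odot>\<^bsub>M\<^esub> (x \<ominus>\<^bsub>M\<^esub> c \<odot>\<^bsub>M\<^esub> a)"
    using assms by (simp add: a_minus_def smult_r_distr smult_assoc1 smult_r_minus)
  then show ?thesis using submoduleE(4)[OF assms(1)] assms by simp
qed

end

context
  fixes k :: "('k, 's) ring_scheme" and V :: "('k, 'v, 'x) module_scheme"
    and W :: "('k, 'w, 'y) module_scheme" and h
  assumes V: "module k V" and W: "module k W" and h: "h \<in> linear_maps k V W"
begin

lemma linear_map_closed: "x \<in> carrier V \<Longrightarrow> h x \<in> carrier W"
  and linear_map_add: "\<lbrakk>x \<in> carrier V; y \<in> carrier V\<rbrakk> \<Longrightarrow> h (x \<oplus>\<^bsub>V\<^esub> y) = h x \<oplus>\<^bsub>W\<^esub> h y"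
  and linear_map_smult: "\<lbrakk>c \<in> carrier k; x \<in> carrier V\<rbrakk> \<Longrightarrow> h (c \<odot>\<^bsub>V\<^esub> x) = c \<odot>\<^bsub>W\<^esub> h x"
  using h by (auto simp: linear_maps_def)

interpretation V: module k V by (rule V)
interpretation W: module k W by (rule W)

lemma linear_map_zero: "h \<zero>\<^bsub>V\<^esub> = \<zero>\<^bsub>W\<^esub>"
  using linear_map_smult[of "\<zero>\<^bsub>k\<^esub>" "\<zero>\<^bsub>V\<^esub>"] linear_map_closed[of "\<zero>\<^bsub>V\<^esub>"] by simp

lemma linear_map_minus:
  assumes "x \<in> carrier V" shows "h (\<ominus>\<^bsub>V\<^esub> x) = \<ominus>\<^bsub>W\<^esub> h x"
  using linear_map_smult[of "\<ominus>\<^bsub>k\<^esub> \<one>\<^bsub>k\<^esub>" x] assms linear_map_closed[of x]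
  by (simp add: V.smult_l_minus W.smult_l_minus)

lemma linear_map_diff:
  "\<lbrakk>x \<in> carrier V; y \<in> carrier V\<rbrakk> \<Longrightarrow> h (x \<ominus>\<^bsub>V\<^esub> y) = h x \<ominus>\<^bsub>W\<^esub> h y"
  by (simp add: a_minus_def linear_map_add linear_map_minus)

lemma linear_map_generated_submodule:
  assumes S: "S \<subseteq> carrier V" and L: "submodule L k W" and SL: "h ` S \<subseteq> L"
  shows "h ` generated_submodule k V S \<subseteq> L"
proof -
  let ?H = "{x \<in> carrier V. h x \<in> L}"
  have "submodule ?H k V"
    using W.submodule_zero[OF L] W.submoduleE[OF L]
    by (intro V.submoduleI)
      (auto simp: linear_map_zero linear_map_add linear_map_smult linear_map_minus)
  then have "generated_submodule k V S \<subseteq> ?H"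
    using S SL by (intro V.generated_submodule_minimal) auto
  then show ?thesis by blast
qed

end

section \<open>Submodules of modules over a category\<close>

lemma cat_submodule_act:
  assumes "cat_submodule C k M N" "x \<in> Obj C" "y \<in> Obj C" "f \<in> Hom C x y" "v \<in> N x"
  shows "act M x y f v \<in> N y"
  using assms unfolding cat_submodule_def by blast

text \<open>
  The right-hand sides form a submodule of \<open>M\<close>, because composing an arrow out of \<open>x\<close> with a further
  arrow gives an arrow out of \<open>x\<close>.
\<close>

lemma (in cat_module) cat_span_subset_generated:
  assumes "category C" and X: "X \<subseteq> (SIGMA x:Obj C. carrier (val M x))" and z: "z \<in> Obj C"
  shows "cat_span C k M X z
    \<subseteq> generated_submodule k (val M z) (\<Union>(x, v)\<in>X. (\<lambda>f. act M x z f v) ` Hom C x z)"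
proof -
  interpret category C by fact
  define S where "S z = (\<Union>(x, v)\<in>X. (\<lambda>f. act M x z f v) ` Hom C x z)" for z
  define K where "K z = generated_submodule k (val M z) (S z)" for z
  have X_D: "x \<in> Obj C" "v \<in> carrier (val M x)" if "(x, v) \<in> X" for x v using that X by auto
  have S: "S z \<subseteq> carrier (val M z)" if "z \<in> Obj C" for z
  proof
    fix u assume "u \<in> S z"
    then obtain x v f where "(x, v) \<in> X" "f \<in> Hom C x z" "u = act M x z f v" by (auto simp: S_def)
    then show "u \<in> carrier (val M z)"
      using linear_map_closed[OF val_module val_module act_linear] X_D that by blast
  qed
  have K: "submodule (K z) k (val M z)" if "z \<in> Obj C" for z
    unfolding K_def using that by (intro module.submodule_generated_submodule val_module S)
  have S_K: "S z \<subseteq> K z" if "z \<in> Obj C" for z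
    unfolding K_def using module.generated_submodule_incl[OF val_module[OF that]] .
  have "act M y z h ` K y \<subseteq> K z" if yz: "y \<in> Obj C" "z \<in> Obj C" and h: "h \<in> Hom C y z" for y z h
    unfolding K_def[of y]
  proof (rule linear_map_generated_submodule[OF val_module[OF yz(1)] val_module[OF yz(2)]
        act_linear[OF yz h] S[OF yz(1)] K[OF yz(2)]], intro image_subsetI)
    fix u assume "u \<in> S y"
    then obtain x v f where xvf: "(x, v) \<in> X" "f \<in> Hom C x y" "u = act M x y f v" by (auto simp: S_def)
    then have "act M y z h u = act M x z (Comp C x y z h f) v"
      using act_comp X_D yz h by simp
    moreover have "Comp C x y z h f \<in> Hom C x z" using comp_hom X_D xvf yz h by blast
    ultimately have "act M y z h u \<in> S z" using xvf(1) unfolding S_def by blast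
    then show "act M y z h u \<in> K z" using S_K[OF yz(2)] by blast
  qed
  then have "cat_submodule C k M K" using K by (simp add: cat_submodule_def)
  moreover have "v \<in> K x" if xv: "(x, v) \<in> X" for x v
  proof -
    have "v = act M x x (Ident C x) v" "Ident C x \<in> Hom C x x"
      using act_ident ident_hom X_D[OF xv] by simp_all
    then have "v \<in> S x" using xv unfolding S_def by blast
    then show ?thesis using S_K X_D[OF xv] by blast
  qed
  ultimately have "cat_span C k M X z \<subseteq> K z" unfolding cat_span_def by blast
  then show ?thesis by (simp add: K_def S_def)
qed

lemma (in cat_module) cat_submodule_of_restrict_module:
  assumes N: "cat_submodule C k M N" and N': "cat_submodule C k (restrict_module M N) N'"
  shows "cat_submodule C k M N'" and "x \<in> Obj C \<Longrightarrow> N' x \<subseteq> N x"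
proof -
  have sub: "N' x \<subseteq> N x \<and> submodule (N' x) k (val M x)" if x: "x \<in> Obj C" for x
  proof -
    interpret V: module k "val M x" using x by (rule val_module)
    have Nx: "submodule (N x) k (val M x)" using N x by (simp add: cat_submodule_def)
    let ?W = "(val M x)\<lparr>carrier := N x\<rparr>"
    have W: "module k ?W" using submodule.submodule_is_module[OF Nx] V.module_axioms by blast
    have N'x: "submodule (N' x) k ?W" using N' x by (simp add: cat_submodule_def restrict_module_def)
    have incl: "N' x \<subseteq> N x" using module.submoduleE(1)[OF W N'x] by simp
    have "module k (?W\<lparr>carrier := N' x\<rparr>)" using submodule.submodule_is_module[OF N'x W] .
    then have "module k ((val M x)\<lparr>carrier := N' x\<rparr>)" by simp
    then have "submodule (N' x) k (val M x)"
      using incl V.submoduleE(1)[OF Nx] by (intro V.module_incl_imp_submodule) auto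
    with incl show ?thesis ..
  qed
  show "cat_submodule C k M N'"
    using N' sub by (simp add: cat_submodule_def restrict_module_def)
  show "x \<in> Obj C \<Longrightarrow> N' x \<subseteq> N x" using sub by blast
qed

section \<open>Modules over a category with a Groebner presentation\<close>

text \<open>
  The setting of Groebner bases for the values of \<open>M\<close> at a family \<open>F\<close> of objects. The value at \<open>F n\<close>
  is generated by the elements \<open>gen t\<close> for the finitely many terms \<open>t\<close> of level \<open>n\<close>, which \<open>rank\<close>
  orders linearly. If \<open>emb s t\<close> then some arrow moves \<open>gen s\<close> to \<open>gen t\<close> and moves the generators
  ranked below \<open>s\<close> to generators ranked below \<open>t\<close>, so that it respects leading terms at \<open>s\<close>. Relations
  between the generators are allowed. The generators are indexed by levels instead of objects since
  the objects \<open>F n\<close> need not be distinct.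
\<close>

locale groebner_presentation = cat_module C k M
  for C :: "('o, 'm) category_data" and k :: "('k, 's) ring_scheme"
    and M :: "('o, 'm, 'k, 'w) cat_module_data" +
  fixes I :: "'n set" and F :: "'n \<Rightarrow> 'o"
    and T :: "'t set" and level :: "'t \<Rightarrow> 'n" and gen :: "'t \<Rightarrow> 'w" and rank :: "'t \<Rightarrow> nat"
    and emb :: "'t \<Rightarrow> 't \<Rightarrow> bool"
  assumes cring: "cring k" and noetherian: "noetherian_ring k"
    and F_obj: "n \<in> I \<Longrightarrow> F n \<in> Obj C"
    and level: "t \<in> T \<Longrightarrow> level t \<in> I"
    and gen_closed: "t \<in> T \<Longrightarrow> gen t \<in> carrier (val M (F (level t)))"
    and spanned: "n \<in> I \<Longrightarrow> carrier (val M (F n))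
      \<subseteq> generated_submodule k (val M (F n)) (gen ` {t \<in> T. level t = n})"
    and finite_level: "finite {t \<in> T. level t = n}"
    and rank_inj: "\<lbrakk>s \<in> T; t \<in> T; level s = level t; rank s = rank t\<rbrakk> \<Longrightarrow> s = t"
    and wqo: "almost_full_on emb T"
    and transport: "\<lbrakk>s \<in> T; t \<in> T; emb s t\<rbrakk> \<Longrightarrow>
      \<exists>h\<in>Hom C (F (level s)) (F (level t)).
        act M (F (level s)) (F (level t)) h (gen s) = gen t \<and>
        (\<forall>u\<in>T. level u = level s \<and> rank u < rank s \<longrightarrow>
          (\<exists>v\<in>T. level v = level t \<and> rank v < rank t \<and>
            act M (F (level s)) (F (level t)) h (gen u) = gen v))"
begin

abbreviation value_at :: "'n \<Rightarrow> ('k, 'w) module"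
  where "value_at n \<equiv> val M (F n)"

definition span_below :: "nat \<Rightarrow> 'n \<Rightarrow> 'w set"
  where "span_below m n =
    generated_submodule k (value_at n) (gen ` {t \<in> T. level t = n \<and> rank t < m})"

text \<open>
  The element \<open>y\<close> has a representation with leading term \<open>c\<close> times the generator of \<open>t\<close>. As the
  generators may satisfy relations, \<open>y\<close> does not determine \<open>c\<close> or \<open>t\<close>, and \<open>c\<close> may be zero.
\<close>

definition leads :: "'n \<Rightarrow> 't \<Rightarrow> 'k \<Rightarrow> 'w \<Rightarrow> bool"
  where "leads n t c y \<longleftrightarrow> c \<in> carrier k \<and> y \<in> carrier (value_at n) \<and>
    y \<ominus>\<^bsub>value_at n\<^esub> (c \<odot>\<^bsub>value_at n\<^esub> gen t) \<in> span_below (rank t) n"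

lemma module_value_at: "n \<in> I \<Longrightarrow> module k (value_at n)"
  by (intro val_module F_obj)

lemma gens_closed: "gen ` {t \<in> T. level t = n \<and> P t} \<subseteq> carrier (value_at n)"
  using gen_closed by auto

lemma submodule_span_below: "n \<in> I \<Longrightarrow> submodule (span_below m n) k (value_at n)"
  unfolding span_below_def
  by (intro module.submodule_generated_submodule module_value_at gens_closed)

text \<open>
  The arrow maps lower terms to lower terms and \<open>gen s\<close> to \<open>gen t\<close>, so the coefficient survives.
\<close>

lemma leads_transport:
  assumes s: "s \<in> T" and t: "t \<in> T" and st: "emb s t" and y: "leads (level s) s c y"
  shows "\<exists>h\<in>Hom C (F (level s)) (F (level t)).
    leads (level t) t c (act M (F (level s)) (F (level t)) h y)"
proof -
  let ?V = "value_at (level s)" and ?W = "value_at (level t)"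
  from transport[OF s t st] obtain h where h: "h \<in> Hom C (F (level s)) (F (level t))"
    and h_gen: "act M (F (level s)) (F (level t)) h (gen s) = gen t"
    and h_below: "\<And>u. \<lbrakk>u \<in> T; level u = level s; rank u < rank s\<rbrakk> \<Longrightarrow>
      \<exists>v\<in>T. level v = level t \<and> rank v < rank t \<and>
        act M (F (level s)) (F (level t)) h (gen u) = gen v" by blast
  let ?h = "act M (F (level s)) (F (level t)) h"
  have V: "module k ?V" and W: "module k ?W" using s t level module_value_at by auto
  interpret V: module k ?V by (rule V)
  interpret W: module k ?W by (rule W)
  have lin: "?h \<in> linear_maps k ?V ?W"
    using s t level F_obj h by (intro act_linear) auto
  note map = linear_map_closed[OF V W lin] linear_map_smult[OF V W lin] linear_map_diff[OF V W lin]
  have "?h ` span_below (rank s) (level s) \<subseteq> span_below (rank t) (level t)"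
    unfolding span_below_def[of "rank s"]
  proof (rule linear_map_generated_submodule[OF V W lin gens_closed])
    show "submodule (span_below (rank t) (level t)) k ?W"
      using t level by (intro submodule_span_below) auto
    show "?h ` gen ` {t \<in> T. level t = level s \<and> rank t < rank s} \<subseteq> span_below (rank t) (level t)"
    proof (intro image_subsetI, elim imageE CollectE conjE)
      fix x u assume "x = gen u" "u \<in> T" "level u = level s" "rank u < rank s"
      with h_below obtain v where "v \<in> T" "level v = level t" "rank v < rank t" "?h x = gen v"
        by blast
      then show "?h x \<in> span_below (rank t) (level t)"
        unfolding span_below_def by (auto intro!: subsetD[OF W.generated_submodule_incl])
    qed
  qed
  moreover have "?h (y \<ominus>\<^bsub>?V\<^esub> (c \<odot>\<^bsub>?V\<^esub> gen s)) = ?h y \<ominus>\<^bsub>?W\<^esub> (c \<odot>\<^bsub>?W\<^esub> gen t)"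
    using y gen_closed[OF s] by (simp add: map h_gen leads_def)
  ultimately have "leads (level t) t c (?h y)"
    using y map(1) unfolding leads_def by (metis image_subset_iff)
  with h show ?thesis by blast
qed

text \<open>
  It is for this lemma that \<open>leads\<close> admits \<open>c = \<zero>\<close>.
\<close>

lemma ideal_leads:
  assumes t: "t \<in> T" and H: "submodule H k (value_at (level t))"
  shows "ideal {c. \<exists>y\<in>H. leads (level t) t c y} k"
proof (rule cring.idealI_left[OF cring])
  let ?V = "value_at (level t)" and ?L = "span_below (rank t) (level t)"
  interpret V: module k ?V using t level module_value_at by blast
  note H_closed = V.submodule_zero[OF H] V.submoduleE(1,4,5)[OF H]
  have L: "submodule ?L k ?V" using t level submodule_span_below by blast
  show "{c. \<exists>y\<in>H. leads (level t) t c y} \<subseteq> carrier k" by (auto simp: leads_def)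
  have "leads (level t) t \<zero>\<^bsub>k\<^esub> \<zero>\<^bsub>?V\<^esub>"
    using gen_closed[OF t] V.submoduleE(3)[OF L V.submodule_zero[OF L]]
    by (simp add: leads_def a_minus_def)
  then show "{c. \<exists>y\<in>H. leads (level t) t c y} \<noteq> {}" using H_closed(1) by blast
  fix a b assume b: "b \<in> {c. \<exists>y\<in>H. leads (level t) t c y}"
  then obtain y where y: "y \<in> H" "leads (level t) t b y" by blast
  {
    assume "a \<in> {c. \<exists>y\<in>H. leads (level t) t c y}"
    then obtain x where x: "x \<in> H" "leads (level t) t a x" by blast
    then have "leads (level t) t (a \<oplus>\<^bsub>k\<^esub> b) (x \<oplus>\<^bsub>?V\<^esub> y)"
      using y V.lead_coeff_add[OF L gen_closed[OF t]] by (auto simp: leads_def)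
    then show "a \<oplus>\<^bsub>k\<^esub> b \<in> {c. \<exists>y\<in>H. leads (level t) t c y}" using H_closed(4) x y by blast
  next
    assume a: "a \<in> carrier k"
    then have "leads (level t) t (a \<otimes>\<^bsub>k\<^esub> b) (a \<odot>\<^bsub>?V\<^esub> y)"
      using y V.lead_coeff_smult[OF L gen_closed[OF t]] by (auto simp: leads_def)
    then show "a \<otimes>\<^bsub>k\<^esub> b \<in> {c. \<exists>y\<in>H. leads (level t) t c y}" using H_closed(3) a y by blast
  }
qed

text \<open>
  Choose finitely many elements of \<open>N\<close>, with leading terms, whose leading coefficients generate at
  every term the ideal of all leading coefficients of \<open>N\<close> there, after transport along \<open>emb\<close>. A
  submodule \<open>N'\<close> of \<open>N\<close> that contains them has the same leading coefficients as \<open>N\<close>, so the division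
  algorithm works: from an element of \<open>N\<close> with leading term at rank \<open>m\<close> subtract an element of \<open>N'\<close>
  with the same leading term, and continue with the difference, which lies in \<open>N\<close> and in the span of
  the generators of rank below \<open>m\<close>.
\<close>

theorem finitely_determined:
  assumes N: "cat_submodule C k M N"
  shows "\<exists>G. finite G \<and> G \<subseteq> (SIGMA n:I. N (F n)) \<and>
    (\<forall>N'. cat_submodule C k M N' \<longrightarrow> (\<forall>x\<in>Obj C. N' x \<subseteq> N x) \<longrightarrow> (\<forall>(n, y)\<in>G. y \<in> N' (F n)) \<longrightarrow>
      (\<forall>n\<in>I. N (F n) \<subseteq> N' (F n)))"
proof -
  interpret k: cring k by (rule cring)
  define L where "L = {(t, c, y). t \<in> T \<and> y \<in> N (F (level t)) \<and> leads (level t) t c y}"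
  have "fst ` L \<subseteq> T" "(fst \<circ> snd) ` L \<subseteq> carrier k" by (auto simp: L_def leads_def)
  from noetherian_ring.finite_generating_coefficients[OF noetherian wqo this]
  obtain G where G: "G \<subseteq> L" "finite G"
    and lead_in_ideal: "\<forall>p\<in>L. (fst \<circ> snd) p \<in> Idl\<^bsub>k\<^esub> ((fst \<circ> snd) ` {q \<in> G. emb (fst q) (fst p)})"
    by (elim exE conjE)
  show ?thesis
  proof (intro exI[of _ "(\<lambda>(t, c, y). (level t, y)) ` G"] conjI allI impI ballI)
    show "finite ((\<lambda>(t, c, y). (level t, y)) ` G)" using G(2) by simp
    show "(\<lambda>(t, c, y). (level t, y)) ` G \<subseteq> (SIGMA n:I. N (F n))"
      using G(1) level by (auto simp: L_def)
  next
    fix N' n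
    assume N': "cat_submodule C k M N'" "\<forall>x\<in>Obj C. N' x \<subseteq> N x" and n: "n \<in> I"
      and "\<forall>(n, y)\<in>(\<lambda>(t, c, y). (level t, y)) ` G. y \<in> N' (F n)"
    then have G_N': "y \<in> N' (F (level t))" if "(t, c, y) \<in> G" for t c y using that by auto
    let ?V = "value_at n"
    interpret V: module k ?V using n by (rule module_value_at)
    have sub: "submodule (N (F n)) k ?V" "submodule (N' (F n)) k ?V" "N' (F n) \<subseteq> N (F n)"
      using N N' F_obj[OF n] by (auto simp: cat_submodule_def)
    note N_carrier = V.submoduleE(1)[OF sub(1)]
    have reduce: "\<exists>y'\<in>N' (F n). leads n t c y'"
      if t: "t \<in> T" "level t = n" and y: "y \<in> N (F n)" "leads n t c y" for t c y
    proof -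
      let ?J = "{c. \<exists>y'\<in>N' (F n). leads n t c y'}"
      have "(t, c, y) \<in> L" using t y by (simp add: L_def)
      then have "c \<in> Idl\<^bsub>k\<^esub> ((fst \<circ> snd) ` {q \<in> G. emb (fst q) t})" using lead_in_ideal by fastforce
      also have "\<dots> \<subseteq> ?J"
      proof (rule k.genideal_minimal)
        show "ideal ?J k" using ideal_leads[OF t(1)] sub(2) t(2) by blast
        show "(fst \<circ> snd) ` {q \<in> G. emb (fst q) t} \<subseteq> ?J"
        proof (intro image_subsetI, elim CollectE conjE)
          fix q assume q: "q \<in> G" "emb (fst q) t"
          obtain s d z where sdz: "q = (s, d, z)" by (cases q)
          with q G(1) have s: "s \<in> T" "leads (level s) s d z" by (auto simp: L_def)
          from leads_transport[OF s(1) t(1) _ s(2)] q sdz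
          obtain h where h: "h \<in> Hom C (F (level s)) (F (level t))"
            "leads (level t) t d (act M (F (level s)) (F (level t)) h z)" by auto
          have "z \<in> N' (F (level s))" using G_N' q(1) sdz by blast
          then have "act M (F (level s)) (F (level t)) h z \<in> N' (F (level t))"
            using F_obj level s(1) t(1) by (intro cat_submodule_act[OF N'(1) _ _ h(1)]) auto
          then show "(fst \<circ> snd) q \<in> ?J" using h(2) t(2) sdz by auto
        qed
      qed
      finally show ?thesis by blast
    qed
    \<comment> \<open>at most one term of level \<open>n\<close> has rank \<open>m\<close>, so \<open>m\<close> can serve as the induction variable\<close>
    have division: "N (F n) \<inter> span_below m n \<subseteq> N' (F n)" for m
    proof (induction m)
      case 0
      have "submodule {\<zero>\<^bsub>?V\<^esub>} k ?V" by (rule V.submoduleI) auto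
      then have "span_below 0 n \<subseteq> {\<zero>\<^bsub>?V\<^esub>}"
        unfolding span_below_def by (rule V.generated_submodule_minimal) auto
      then show ?case using V.submodule_zero[OF sub(2)] by auto
    next
      case (Suc m)
      show ?case
      proof (cases "\<exists>t\<in>T. level t = n \<and> rank t = m")
        case False
        then have "{t \<in> T. level t = n \<and> rank t < Suc m} = {t \<in> T. level t = n \<and> rank t < m}"
          by (auto simp: less_Suc_eq)
        then show ?thesis using Suc.IH by (simp add: span_below_def)
      next
        case True
        then obtain t where t: "t \<in> T" "level t = n" "rank t = m" by blast
        then have split: "{t \<in> T. level t = n \<and> rank t < Suc m}
            = insert t {t \<in> T. level t = n \<and> rank t < m}"
          using rank_inj by (auto simp: less_Suc_eq)
        have L: "submodule (span_below m n) k ?V" using n by (rule submodule_span_below)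
        show ?thesis
        proof
          fix y assume "y \<in> N (F n) \<inter> span_below (Suc m) n"
          then have y: "y \<in> N (F n)" "y \<in> span_below (Suc m) n" by auto
          have gen_t: "gen t \<in> carrier ?V" using gen_closed[OF t(1)] t(2) by simp
          from y(2) have "y \<in> generated_submodule k ?V
              (insert (gen t) (gen ` {t \<in> T. level t = n \<and> rank t < m}))"
            by (simp only: span_below_def split image_insert)
          from V.generated_submodule_insert[OF gen_t gens_closed this]
          obtain c where c: "c \<in> carrier k"
            "y \<ominus>\<^bsub>?V\<^esub> c \<odot>\<^bsub>?V\<^esub> gen t \<in> span_below m n"
            unfolding span_below_def by (elim bexE)
          have "leads n t c y" using c y(1) t N_carrier by (auto simp: leads_def)
          with reduce[OF t(1,2) y(1)] obtain y' where y': "y' \<in> N' (F n)" "leads n t c y'" by blast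
          have in_V: "y \<in> carrier ?V" "y' \<in> carrier ?V" "c \<odot>\<^bsub>?V\<^esub> gen t \<in> carrier ?V"
            using y(1) y'(1) sub(3) N_carrier c(1) gen_t by auto
          then have "y \<ominus>\<^bsub>?V\<^esub> y' = (y \<ominus>\<^bsub>?V\<^esub> c \<odot>\<^bsub>?V\<^esub> gen t) \<ominus>\<^bsub>?V\<^esub> (y' \<ominus>\<^bsub>?V\<^esub> c \<odot>\<^bsub>?V\<^esub> gen t)"
            by (simp add: a_minus_def V.minus_add V.a_ac V.r_neg V.r_neg1 V.r_neg2)
          \<comment> \<open>the leading terms cancel\<close>
          also have "\<dots> \<in> span_below m n"
            using y'(2) t(3) by (intro V.submodule_diff[OF L c(2)]) (simp add: leads_def)
          finally have "y \<ominus>\<^bsub>?V\<^esub> y' \<in> N' (F n)"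
            using Suc.IH V.submodule_diff[OF sub(1) y(1)] y'(1) sub(3) by blast
          then have "(y \<ominus>\<^bsub>?V\<^esub> y') \<oplus>\<^bsub>?V\<^esub> y' \<in> N' (F n)"
            using y'(1) V.submoduleE(5)[OF sub(2)] by blast
          then show "y \<in> N' (F n)" using in_V by (simp add: a_minus_def V.M.a_assoc V.M.l_neg)
        qed
      qed
    qed
    obtain m where "\<forall>t\<in>{t \<in> T. level t = n}. rank t < m"
      using finite_nat_set_iff_bounded[of "rank ` {t \<in> T. level t = n}"] finite_level by auto
    then have "{t \<in> T. level t = n \<and> rank t < m} = {t \<in> T. level t = n}" by auto
    then have "carrier ?V \<subseteq> span_below m n" using spanned[OF n] by (simp add: span_below_def)
    then show "N (F n) \<subseteq> N' (F n)" using division[of m] N_carrier by blast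
  qed
qed

end

section \<open>Coordinate systems on free modules\<close>

definition functionals :: "('a, 'r) ring_scheme \<Rightarrow> ('a, 'v, 's) module_scheme \<Rightarrow> ('v \<Rightarrow> 'a) set"
  where "functionals R V = {p \<in> extensional (carrier V) \<inter> (carrier V \<rightarrow> carrier R).
    (\<forall>x\<in>carrier V. \<forall>y\<in>carrier V. p (x \<oplus>\<^bsub>V\<^esub> y) = p x \<oplus>\<^bsub>R\<^esub> p y) \<and>
    (\<forall>a\<in>carrier R. \<forall>x\<in>carrier V. p (a \<odot>\<^bsub>V\<^esub> x) = a \<otimes>\<^bsub>R\<^esub> p x)}"

definition coordinates :: "('v \<Rightarrow> 'a) list \<Rightarrow> 'v \<Rightarrow> 'a list"
  where "coordinates ps x = map (\<lambda>p. p x) ps"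

text \<open>
  The dual description of a basis: \<open>n\<close> functionals that identify the module with \<open>R\<^sup>n\<close>. Over the
  zero ring the length \<open>n\<close> is not determined by the module.
\<close>

definition coordinate_system ::
  "('a, 'r) ring_scheme \<Rightarrow> ('a, 'v, 's) module_scheme \<Rightarrow> ('v \<Rightarrow> 'a) list \<Rightarrow> bool"
  where "coordinate_system R V ps \<longleftrightarrow> set ps \<subseteq> functionals R V \<and>
    bij_betw (coordinates ps) (carrier V) {xs. length xs = length ps \<and> set xs \<subseteq> carrier R}"

lemma functionalsD:
  assumes "p \<in> functionals R V"
  shows "x \<in> carrier V \<Longrightarrow> p x \<in> carrier R"
    and "\<lbrakk>x \<in> carrier V; y \<in> carrier V\<rbrakk> \<Longrightarrow> p (x \<oplus>\<^bsub>V\<^esub> y) = p x \<oplus>\<^bsub>R\<^esub> p y"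
    and "\<lbrakk>a \<in> carrier R; x \<in> carrier V\<rbrakk> \<Longrightarrow> p (a \<odot>\<^bsub>V\<^esub> x) = a \<otimes>\<^bsub>R\<^esub> p x"
  using assms by (auto simp: functionals_def)

lemma finite_functionals:
  assumes "finite (carrier R)" "coordinate_system R V ps"
  shows "finite (functionals R V)"
proof -
  have "finite {xs. set xs \<subseteq> carrier R \<and> length xs = length ps}"
    using assms(1) by (rule finite_lists_length_eq)
  then have "finite (carrier V)"
    using assms(2) bij_betw_finite by (fastforce simp: coordinate_system_def conj_commute)
  then have "finite (carrier V \<rightarrow>\<^sub>E carrier R)" using assms(1) by (intro finite_PiE)
  moreover have "functionals R V \<subseteq> carrier V \<rightarrow>\<^sub>E carrier R" by (auto simp: functionals_def PiE_def)
  ultimately show ?thesis by (rule rev_finite_subset)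
qed

context module
begin

definition lincomb :: "'c set \<Rightarrow> ('c \<Rightarrow> 'a) \<Rightarrow> 'c"
  where "lincomb B c = (\<Oplus>\<^bsub>M\<^esub>b\<in>B. c b \<odot>\<^bsub>M\<^esub> b)"

lemma lincomb_closed: "\<lbrakk>B \<subseteq> carrier M; c \<in> B \<rightarrow> carrier R\<rbrakk> \<Longrightarrow> lincomb B c \<in> carrier M"
  unfolding lincomb_def by (intro M.finsum_closed) auto

lemma lincomb_add:
  assumes "B \<subseteq> carrier M" "c \<in> B \<rightarrow> carrier R" "d \<in> B \<rightarrow> carrier R"
  shows "lincomb B (\<lambda>b. c b \<oplus> d b) = lincomb B c \<oplus>\<^bsub>M\<^esub> lincomb B d"
proof -
  have "lincomb B (\<lambda>b. c b \<oplus> d b) = (\<Oplus>\<^bsub>M\<^esub>b\<in>B. c b \<odot>\<^bsub>M\<^esub> b \<oplus>\<^bsub>M\<^esub> d b \<odot>\<^bsub>M\<^esub> b)"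
    unfolding lincomb_def using assms by (intro M.finsum_cong') (auto simp: smult_l_distr Pi_iff)
  also have "\<dots> = lincomb B c \<oplus>\<^bsub>M\<^esub> lincomb B d"
    unfolding lincomb_def using assms by (intro M.finsum_addf) auto
  finally show ?thesis .
qed

lemma lincomb_smult:
  assumes "finite B" "B \<subseteq> carrier M" "c \<in> B \<rightarrow> carrier R" "a \<in> carrier R"
  shows "lincomb B (\<lambda>b. a \<otimes> c b) = a \<odot>\<^bsub>M\<^esub> lincomb B c"
proof -
  have "lincomb B (\<lambda>b. a \<otimes> c b) = (\<Oplus>\<^bsub>M\<^esub>b\<in>B. a \<odot>\<^bsub>M\<^esub> (c b \<odot>\<^bsub>M\<^esub> b))"
    unfolding lincomb_def using assms by (intro M.finsum_cong') (auto simp: smult_assoc1 Pi_iff)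
  also have "\<dots> = a \<odot>\<^bsub>M\<^esub> lincomb B c"
    unfolding lincomb_def using assms by (intro finsum_smult_ldistr[symmetric]) auto
  finally show ?thesis .
qed

text \<open>
  The coefficient functions of a basis serve as coordinates; linear independence makes them well
  defined and linear.
\<close>

lemma ex_coordinate_system:
  assumes "finite_basis R M B"
  shows "\<exists>ps. coordinate_system R M ps"
proof -
  have B: "finite B" "B \<subseteq> carrier M"
    and span: "\<And>x. x \<in> carrier M \<Longrightarrow> \<exists>c\<in>B \<rightarrow> carrier R. x = lincomb B c"
    and indep: "\<And>c b. \<lbrakk>c \<in> B \<rightarrow> carrier R; lincomb B c = \<zero>\<^bsub>M\<^esub>; b \<in> B\<rbrakk> \<Longrightarrow> c b = \<zero>"
    using assms by (auto simp: finite_basis_def lincomb_def)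
  have unique: "c b = d b"
    if c: "c \<in> B \<rightarrow> carrier R" and d: "d \<in> B \<rightarrow> carrier R"
      and eq: "lincomb B c = lincomb B d" and b: "b \<in> B" for c d b
  proof -
    let ?d = "\<lambda>b. \<ominus> \<one> \<otimes> d b"
    have neg: "?d \<in> B \<rightarrow> carrier R" using d by auto
    have "lincomb B (\<lambda>b. c b \<oplus> ?d b) = lincomb B c \<oplus>\<^bsub>M\<^esub> (\<ominus> \<one>) \<odot>\<^bsub>M\<^esub> lincomb B d"
      using lincomb_add[OF B(2) c neg] lincomb_smult[OF B d, of "\<ominus> \<one>"] by simp
    also have "\<dots> = \<zero>\<^bsub>M\<^esub>"
      using lincomb_closed[OF B(2) d] eq by (simp add: smult_l_minus M.r_neg)
    finally have "c b \<oplus> ?d b = \<zero>" using c neg b by (intro indep[of "\<lambda>b. c b \<oplus> ?d b"]) auto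
    moreover have "c b \<in> carrier R" "d b \<in> carrier R" using c d b by auto
    ultimately show ?thesis
      by (simp add: l_minus R.minus_equality)
        (metis R.add.inv_solve_right' R.l_zero R.zero_closed)
  qed
  obtain co where co: "\<And>x. x \<in> carrier M \<Longrightarrow> co x \<in> B \<rightarrow> carrier R \<and> x = lincomb B (co x)"
    using span by metis
  then have co_Pi: "co x \<in> B \<rightarrow> carrier R" and co_eq: "lincomb B (co x) = x" if "x \<in> carrier M" for x
    using that by metis+
  have co_R: "co x b \<in> carrier R" if "x \<in> carrier M" "b \<in> B" for x b
    using co_Pi that by blast
  have co_lincomb: "co (lincomb B c) b = c b" if "c \<in> B \<rightarrow> carrier R" "b \<in> B" for c b
    using that co_Pi co_eq lincomb_closed[OF B(2) that(1)] by (intro unique[OF _ that(1)])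
  obtain bs where bs: "set bs = B" "distinct bs" using finite_distinct_list[OF B(1)] by blast
  define p where "p b = (\<lambda>x\<in>carrier M. co x b)" for b
  define ps where "ps = map p bs"
  have "p b \<in> functionals R M" if b: "b \<in> B" for b
    unfolding functionals_def
  proof (intro CollectI IntI conjI ballI)
    fix x y assume xy: "x \<in> carrier M" "y \<in> carrier M"
    have "co (lincomb B (\<lambda>b. co x b \<oplus> co y b)) b = co x b \<oplus> co y b"
      using b co_R xy by (intro co_lincomb) auto
    moreover have "lincomb B (\<lambda>b. co x b \<oplus> co y b) = x \<oplus>\<^bsub>M\<^esub> y"
      using lincomb_add[OF B(2) co_Pi[OF xy(1)] co_Pi[OF xy(2)]]
      by (simp only: co_eq[OF xy(1)] co_eq[OF xy(2)])
    ultimately show "p b (x \<oplus>\<^bsub>M\<^esub> y) = p b x \<oplus> p b y" using xy by (simp add: p_def)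
  next
    fix a x assume ax: "a \<in> carrier R" "x \<in> carrier M"
    have "co (lincomb B (\<lambda>b. a \<otimes> co x b)) b = a \<otimes> co x b"
      using b co_R ax by (intro co_lincomb) auto
    moreover have "lincomb B (\<lambda>b. a \<otimes> co x b) = a \<odot>\<^bsub>M\<^esub> x"
      using lincomb_smult[OF B co_Pi[OF ax(2)] ax(1)] by (simp only: co_eq[OF ax(2)])
    ultimately show "p b (a \<odot>\<^bsub>M\<^esub> x) = a \<otimes> p b x" using ax by (simp add: p_def)
  qed (auto simp: p_def co_R b)
  then have ps: "set ps \<subseteq> functionals R M" by (auto simp: ps_def bs)
  have coordinates_ps: "coordinates ps x = map (co x) bs" if "x \<in> carrier M" for x
    using that by (simp add: coordinates_def ps_def p_def)
  have "bij_betw (coordinates ps) (carrier M) {xs. length xs = length ps \<and> set xs \<subseteq> carrier R}"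
  proof (rule bij_betwI')
    fix x y assume xy: "x \<in> carrier M" "y \<in> carrier M"
    have "x = y" if "map (co x) bs = map (co y) bs"
    proof -
      have "\<forall>b\<in>B. co x b = co y b" using that bs(1) by auto
      then have "lincomb B (co x) = lincomb B (co y)"
        unfolding lincomb_def using co_R xy B by (intro M.finsum_cong') auto
      then show ?thesis using co_eq[OF xy(1)] co_eq[OF xy(2)] by simp
    qed
    then show "(coordinates ps x = coordinates ps y) = (x = y)"
      using xy by (auto simp: coordinates_ps)
  next
    fix x assume x: "x \<in> carrier M"
    show "coordinates ps x \<in> {xs. length xs = length ps \<and> set xs \<subseteq> carrier R}"
      unfolding coordinates_ps[OF x] using co_R[OF x] bs(1) by (auto simp: ps_def)
  next
    fix xs assume xs: "xs \<in> {xs. length xs = length ps \<and> set xs \<subseteq> carrier R}"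
    then have len: "length bs = length xs" by (simp add: ps_def)
    define c where "c b = the (map_of (zip bs xs) b)" for b
    have c_nth: "c (bs ! i) = xs ! i" if "i < length bs" for i
      using that len bs(2) by (simp add: c_def map_of_zip_nth)
    have c: "c \<in> B \<rightarrow> carrier R"
    proof
      fix b assume "b \<in> B"
      then obtain i where i: "i < length bs" "b = bs ! i" using bs(1) by (metis in_set_conv_nth)
      then have "xs ! i \<in> carrier R" using xs len nth_mem[of i xs] by auto
      then show "c b \<in> carrier R" using i c_nth by simp
    qed
    have "map (co (lincomb B c)) bs = xs"
      using len bs(1) c_nth co_lincomb[OF c] by (intro nth_equalityI) auto
    then show "\<exists>x\<in>carrier M. xs = coordinates ps x"
      using lincomb_closed[OF B(2) c] by (auto simp: coordinates_ps)
  qed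
  with ps show ?thesis unfolding coordinate_system_def by blast
qed

end

text \<open>
  A word \<open>w\<close> of functionals on \<open>V\<close>, one for each coordinate of \<open>W\<close>, is the same as a linear map from
  \<open>V\<close> to \<open>W\<close>.
\<close>

definition word_map :: "('a, 'v, 's) module_scheme \<Rightarrow> ('a, 'w, 't) module_scheme
    \<Rightarrow> ('w \<Rightarrow> 'a) list \<Rightarrow> ('v \<Rightarrow> 'a) list \<Rightarrow> 'v \<Rightarrow> 'w"
  where "word_map V W ps w =
    (\<lambda>x\<in>carrier V. inv_into (carrier W) (coordinates ps) (coordinates w x))"

lemma word_map_extensional: "word_map V W ps w \<in> extensional (carrier V)"
  by (simp add: word_map_def)

lemma coordinate_system_eqI:
  assumes cs: "coordinate_system R W ps" and "y \<in> carrier W" "z \<in> carrier W"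
    and "\<And>i. i < length ps \<Longrightarrow> (ps ! i) y = (ps ! i) z"
  shows "y = z"
proof -
  have "coordinates ps y = coordinates ps z"
    using assms(4) by (intro nth_equalityI) (simp_all add: coordinates_def)
  then show ?thesis using assms(1-3) by (auto simp: coordinate_system_def bij_betw_def dest: inj_onD)
qed

lemma
  assumes "coordinate_system R W ps" "set w \<subseteq> functionals R V" "length w = length ps"
    and x: "x \<in> carrier V"
  shows word_map_closed: "word_map V W ps w x \<in> carrier W"
    and nth_word_map: "i < length ps \<Longrightarrow> (ps ! i) (word_map V W ps w x) = (w ! i) x"
proof -
  have "coordinates w x \<in> {xs. length xs = length ps \<and> set xs \<subseteq> carrier R}"
    using assms functionalsD(1) by (fastforce simp: coordinates_def)
  also have "\<dots> = coordinates ps ` carrier W"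
    using assms(1) by (simp add: coordinate_system_def bij_betw_def)
  finally have *: "coordinates w x \<in> coordinates ps ` carrier W" .
  then show "word_map V W ps w x \<in> carrier W" using x by (simp add: word_map_def inv_into_into)
  have "coordinates ps (word_map V W ps w x) = coordinates w x"
    using * x by (simp add: word_map_def f_inv_into_f)
  then show "i < length ps \<Longrightarrow> (ps ! i) (word_map V W ps w x) = (w ! i) x"
    using assms(3) by (metis coordinates_def nth_map)
qed

lemma word_map_linear:
  assumes cs: "coordinate_system R W ps" and w: "set w \<subseteq> functionals R V" "length w = length ps"
    and V: "module R V" and W: "module R W"
  shows "word_map V W ps w \<in> linear_maps R V W"
proof -
  interpret V: module R V by (rule V)
  interpret W: module R W by (rule W)
  note closed = word_map_closed[OF cs w] and nth = nth_word_map[OF cs w]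
  have p: "ps ! i \<in> functionals R W" and v: "w ! i \<in> functionals R V" if "i < length ps" for i
    using that cs w by (auto simp: coordinate_system_def)
  show ?thesis
    unfolding linear_maps_def
  proof (intro CollectI conjI ballI funcsetI)
    fix x y assume "x \<in> carrier V" "y \<in> carrier V"
    then show "word_map V W ps w (x \<oplus>\<^bsub>V\<^esub> y) = word_map V W ps w x \<oplus>\<^bsub>W\<^esub> word_map V W ps w y"
      by (intro coordinate_system_eqI[OF cs])
        (simp_all add: closed nth functionalsD(2)[OF p] functionalsD(2)[OF v])
  next
    fix a x assume "a \<in> carrier R" "x \<in> carrier V"
    then show "word_map V W ps w (a \<odot>\<^bsub>V\<^esub> x) = a \<odot>\<^bsub>W\<^esub> word_map V W ps w x"
      by (intro coordinate_system_eqI[OF cs])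
        (simp_all add: closed nth functionalsD(3)[OF p] functionalsD(3)[OF v])
  qed (rule closed)
qed

lemma linear_map_eq_word_map:
  assumes cs: "coordinate_system R W ps" and V: "module R V"
    and f: "f \<in> linear_maps R V W" "f \<in> extensional (carrier V)"
  shows "\<exists>w. set w \<subseteq> functionals R V \<and> length w = length ps \<and> f = word_map V W ps w"
proof -
  interpret V: module R V by (rule V)
  let ?w = "map (\<lambda>p. \<lambda>x\<in>carrier V. p (f x)) ps"
  have f_closed: "f x \<in> carrier W" if "x \<in> carrier V" for x
    using f(1) that by (auto simp: linear_maps_def)
  have "(\<lambda>x\<in>carrier V. p (f x)) \<in> functionals R V" if "p \<in> functionals R W" for p
    using f(1) f_closed functionalsD[OF that] unfolding functionals_def linear_maps_def by auto
  then have w: "set ?w \<subseteq> functionals R V" using cs by (auto simp: coordinate_system_def)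
  have "f x = word_map V W ps ?w x" for x
  proof (cases "x \<in> carrier V")
    case True
    then show ?thesis
      using word_map_closed[OF cs w] nth_word_map[OF cs w] f_closed
      by (intro coordinate_system_eqI[OF cs]) simp_all
  next
    case False
    then show ?thesis using f(2) by (simp add: extensional_def word_map_def)
  qed
  then have "f = word_map V W ps ?w" by (rule ext)
  then show ?thesis using w by (intro exI[of _ ?w] conjI) simp_all
qed

lemma set_map_nth_subset: "\<lbrakk>set g \<subseteq> {..<length xs}; set xs \<subseteq> A\<rbrakk> \<Longrightarrow> set (map ((!) xs) g) \<subseteq> A"
  by (auto intro: subsetD nth_mem)

text \<open>
  Words whose letters are coordinates \<open>ps ! i\<close> of \<open>W\<close> are the maps \<open>R\<^sup>n \<rightarrow> R\<^sup>m\<close> induced by a map \<open>g\<close> of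
  positions. Composition with them precomposes a word with \<open>g\<close>.
\<close>

lemma compose_word_map:
  assumes W: "coordinate_system R W ps" and X: "coordinate_system R X qs"
    and w: "set w \<subseteq> functionals R V" "length w = length ps"
    and g: "set g \<subseteq> {..<length ps}" "length g = length qs"
  shows "compose (carrier V) (word_map W X qs (map ((!) ps) g)) (word_map V W ps w)
    = word_map V X qs (map ((!) w) g)"
proof
  fix x
  have ps: "set ps \<subseteq> functionals R W" using W by (simp add: coordinate_system_def)
  have pg: "set (map ((!) ps) g) \<subseteq> functionals R W" "length (map ((!) ps) g) = length qs"
    using set_map_nth_subset[OF g(1) ps] g(2) by simp_all
  have wg: "set (map ((!) w) g) \<subseteq> functionals R V" "length (map ((!) w) g) = length qs"
    using set_map_nth_subset[OF _ w(1)] g w(2) by simp_all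
  show "compose (carrier V) (word_map W X qs (map ((!) ps) g)) (word_map V W ps w) x
    = word_map V X qs (map ((!) w) g) x"
  proof (cases "x \<in> carrier V")
    case True
    have y: "word_map V W ps w x \<in> carrier W" by (rule word_map_closed[OF W w True])
    show ?thesis
      unfolding compose_eq[OF True]
    proof (rule coordinate_system_eqI[OF X])
      fix i assume i: "i < length qs"
      then have gi: "g ! i < length ps" using subsetD[OF g(1) nth_mem[of i g]] g(2) by simp
      have "(qs ! i) (word_map W X qs (map ((!) ps) g) (word_map V W ps w x))
          = (ps ! (g ! i)) (word_map V W ps w x)"
        using nth_word_map[OF X pg y i] i g(2) by simp
      also have "\<dots> = (w ! (g ! i)) x" by (rule nth_word_map[OF W w True gi])
      also have "\<dots> = (qs ! i) (word_map V X qs (map ((!) w) g) x)"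
        using nth_word_map[OF X wg True i] i g(2) by simp
      finally show "(qs ! i) (word_map W X qs (map ((!) ps) g) (word_map V W ps w x))
          = (qs ! i) (word_map V X qs (map ((!) w) g) x)" .
    qed (rule word_map_closed[OF X pg y] word_map_closed[OF X wg True])+
  qed (simp add: compose_def word_map_def)
qed

lemma word_map_ident:
  assumes "coordinate_system R V ps"
  shows "word_map V V ps ps = (\<lambda>x\<in>carrier V. x)"
proof
  fix x
  have ps: "set ps \<subseteq> functionals R V" using assms by (simp add: coordinate_system_def)
  show "word_map V V ps ps x = (\<lambda>x\<in>carrier V. x) x"
  proof (cases "x \<in> carrier V")
    case True
    have "word_map V V ps ps x = x"
      using word_map_closed[OF assms ps refl True] True nth_word_map[OF assms ps refl True]
      by (rule coordinate_system_eqI[OF assms])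
    then show ?thesis using True by simp
  qed (simp add: word_map_def)
qed

text \<open>
  A section of \<open>g\<close> induces a left inverse of the map induced by \<open>g\<close>, by contravariance.
\<close>

lemma word_map_splittable:
  assumes W: "coordinate_system R W ps" "module R W" and X: "coordinate_system R X qs" "module R X"
    and g: "set g \<subseteq> {..<length ps}" "length g = length qs"
    and s: "set s \<subseteq> {..<length qs}" "map ((!) g) s = [0..<length ps]"
  shows "word_map W X qs (map ((!) ps) g) \<in> splittable_injections R W X"
proof -
  let ?f = "word_map W X qs (map ((!) ps) g)" and ?h = "word_map X W ps (map ((!) qs) s)"
  have ps: "set ps \<subseteq> functionals R W" and qs: "set qs \<subseteq> functionals R X"
    using W X by (simp_all add: coordinate_system_def)
  have len_s: "length s = length ps" using s(2) by (metis length_map length_upt diff_zero)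
  have pg: "set (map ((!) ps) g) \<subseteq> functionals R W" "length (map ((!) ps) g) = length qs"
    using set_map_nth_subset[OF g(1) ps] g(2) by simp_all
  have qsec: "set (map ((!) qs) s) \<subseteq> functionals R X" "length (map ((!) qs) s) = length ps"
    using set_map_nth_subset[OF s(1) qs] len_s by simp_all
  have "map ((!) (map ((!) ps) g)) s = map ((!) ps) (map ((!) g) s)"
    using s(1) g(2) by auto
  also have "\<dots> = ps" unfolding s(2) by (rule map_nth)
  finally have "compose (carrier W) ?h ?f = (\<lambda>x\<in>carrier W. x)"
    using compose_word_map[OF X(1) W(1) pg s(1) len_s] word_map_ident[OF W(1)] by simp
  then have inv: "?h (?f x) = x" if "x \<in> carrier W" for x
    using that by (metis compose_eq restrict_apply')
  have "?f \<in> linear_maps R W X" by (rule word_map_linear[OF X(1) pg W(2) X(2)])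
  moreover have "?h \<in> linear_maps R X W" by (rule word_map_linear[OF W(1) qsec X(2) W(2)])
  moreover have "inj_on ?f (carrier W)" using inv by (rule inj_on_inverseI)
  ultimately show ?thesis using inv unfolding splittable_injections_def by blast
qed

section \<open>Modules over the category of splittable injections\<close>

lemma
  shows Obj_VI: "V \<in> Obj (VI R) \<longleftrightarrow> finite_free_module R V"
    and Hom_VI: "f \<in> Hom (VI R) V W \<longleftrightarrow>
      f \<in> splittable_injections R V W \<and> f \<in> extensional (carrier V)"
    and Comp_VI: "Comp (VI R) U V W g f = compose (carrier U) g f"
    and Ident_VI: "Ident (VI R) V = (\<lambda>x\<in>carrier V. x)"
  by (simp_all add: VI_def)

lemma module_Obj_VI: "V \<in> Obj (VI R) \<Longrightarrow> module R V"
  by (simp add: Obj_VI finite_free_module_def)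

lemma ex_coordinate_system_Obj_VI: "V \<in> Obj (VI R) \<Longrightarrow> \<exists>ps. coordinate_system R V ps"
  using module.ex_coordinate_system[of R V] by (auto simp: Obj_VI finite_free_module_def)

lemma word_map_ordered_surj_VI:
  assumes V: "V \<in> Obj (VI R)" "coordinate_system R V ps"
    and W: "W \<in> Obj (VI R)" "coordinate_system R W qs"
    and g: "ordered_surj (length ps) g" "length g = length qs"
  shows "word_map V W qs (map ((!) ps) g) \<in> Hom (VI R) V W"
proof -
  obtain s where "length s = length ps" "set s \<subseteq> {..<length g}"
    and s: "map ((!) g) s = [0..<length ps]"
    by (rule ordered_surj_section[OF g(1)]) (rule that)
  then have "set g \<subseteq> {..<length ps}" "set s \<subseteq> {..<length qs}"
    using set_ordered_surj[OF g(1)] g(2) by simp_all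
  then show ?thesis
    using word_map_splittable[OF V(2) module_Obj_VI[OF V(1)] W(2) module_Obj_VI[OF W(1)] _ g(2) _ s]
    by (simp add: Hom_VI word_map_extensional)
qed

text \<open>
  Objects with coordinate systems of the same length are isomorphic, and submodules are stable under
  isomorphisms.
\<close>

lemma cat_submodule_VI_subset_transfer:
  assumes M: "cat_module (VI R) k M"
    and N: "cat_submodule (VI R) k M N" and N': "cat_submodule (VI R) k M N'"
    and V: "V \<in> Obj (VI R)" "coordinate_system R V ps"
    and W: "W \<in> Obj (VI R)" "coordinate_system R W qs"
    and len: "length ps = length qs" and sub: "N V \<subseteq> N' V"
  shows "N W \<subseteq> N' W"
proof
  fix y assume y: "y \<in> N W"
  interpret M: cat_module "VI R" k M by (rule M)
  let ?f = "word_map W V ps qs" and ?g = "word_map V W qs ps"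
  have ident: "map ((!) ps) [0..<length qs] = ps" "map ((!) qs) [0..<length qs] = qs"
    using map_nth[of ps] map_nth[of qs] len by simp_all
  have f: "?f \<in> Hom (VI R) W V"
    using word_map_ordered_surj_VI[OF W V, of "[0..<length qs]"] ordered_surj_upt[of "length qs"] len
    by (simp only: ident length_upt diff_zero)
  have g: "?g \<in> Hom (VI R) V W"
    using word_map_ordered_surj_VI[OF V W, of "[0..<length qs]"] ordered_surj_upt[of "length qs"] len
    by (simp only: ident length_upt diff_zero)
  have "set qs \<subseteq> functionals R W" using W(2) by (simp add: coordinate_system_def)
  then have "compose (carrier W) ?g ?f = word_map W W qs qs"
    using compose_word_map[OF V(2) W(2), of qs W "[0..<length qs]"] len
    by (simp only: ident length_upt diff_zero set_upt atLeast0LessThan subset_refl)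
  then have gf: "Comp (VI R) W V W ?g ?f = Ident (VI R) W"
    by (simp add: Comp_VI Ident_VI word_map_ident[OF W(2)])
  have "act M W V ?f y \<in> N' V" using cat_submodule_act[OF N W(1) V(1) f y] sub by blast
  then have "act M V W ?g (act M W V ?f y) \<in> N' W" by (rule cat_submodule_act[OF N' V(1) W(1) g])
  moreover have "y \<in> carrier (val M W)"
    using y N W(1) module.submoduleE(1)[OF M.val_module[OF W(1)]] by (auto simp: cat_submodule_def)
  ultimately show "y \<in> N' W"
    using M.act_comp[OF W(1) V(1) W(1) f g, of y] M.act_ident[OF W(1), of y] gf by simp
qed

theorem theorem1:
  fixes R :: "('a, 'r) ring_scheme" and k :: "('k, 's) ring_scheme"
  assumes "cring R" and "finite (carrier R)"
    and "infinite (UNIV :: 'v set)"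
    and "cring k" and "noetherian_ring k"
  shows "locally_noetherian TYPE('w) (VI R :: (('a, 'v) module, 'v \<Rightarrow> 'v) category_data) k"
  unfolding locally_noetherian_def
proof (intro allI impI, elim conjE)
  let ?C = "VI R :: (('a, 'v) module, 'v \<Rightarrow> 'v) category_data"
  fix M :: "(('a, 'v) module, 'v \<Rightarrow> 'v, 'k, 'w) cat_module_data" and N
  assume M: "cat_module ?C k M" and fg: "finitely_generated ?C k M" and N: "cat_submodule ?C k M N"
  interpret M: cat_module ?C k M by (rule M)
  interpret VI: category ?C by (rule category_VI)
  \<comment> \<open>the ranks \<open>n\<close> that occur, and for each a copy \<open>F n\<close> of \<open>R\<^sup>n\<close> with coordinates \<open>P n\<close>\<close>
  define D where "D = {length ps | V ps. V \<in> Obj ?C \<and> coordinate_system R V ps}"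
  have "\<forall>n\<in>D. \<exists>V ps. V \<in> Obj ?C \<and> coordinate_system R V ps \<and> length ps = n" by (auto simp: D_def)
  then obtain F P where F: "\<And>n. n \<in> D \<Longrightarrow> F n \<in> Obj ?C"
    and P: "\<And>n. n \<in> D \<Longrightarrow> coordinate_system R (F n) (P n)" "\<And>n. n \<in> D \<Longrightarrow> length (P n) = n"
    by metis
  obtain X where X: "finite X" "X \<subseteq> (SIGMA V:Obj ?C. carrier (val M V))"
    and X_gen: "\<forall>V\<in>Obj ?C. cat_span ?C k M X V = carrier (val M V)"
    using fg unfolding finitely_generated_def by (elim exE conjE)
  obtain xs where xs: "set xs = X" using finite_list[OF X(1)] by blast
  define V where "V i = fst (xs ! i)" for i
  define x where "x i = snd (xs ! i)" for i
  have Vx: "(V i, x i) \<in> X" "V i \<in> Obj ?C" "x i \<in> carrier (val M (V i))" if "i < length xs" for i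
  proof -
    show *: "(V i, x i) \<in> X" using that xs by (auto simp: V_def x_def)
    then show "V i \<in> Obj ?C" "x i \<in> carrier (val M (V i))" using X(2) by auto
  qed
  define A where "A = (\<Union>i<length xs. functionals R (V i))"
  have "finite A"
    unfolding A_def using ex_coordinate_system_Obj_VI Vx(2) finite_functionals[OF assms(2)] by blast
  then obtain q and d :: "('v \<Rightarrow> 'a) \<Rightarrow> nat" where d: "d ` A = {n. n < q}" "inj_on d A"
    using finite_imp_inj_to_nat_seg by metis
  \<comment> \<open>terms are the words that describe arrows from some \<open>V i\<close>; the \<open>x i\<close> generate \<open>M\<close>\<close>
  define mor where "mor i w = word_map (V i) (F (length w)) (P (length w)) w" for i w
  define T where "T = {(i, w). i < length xs \<and> length w \<in> D \<and> set w \<subseteq> functionals R (V i) \<and>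
    mor i w \<in> Hom ?C (V i) (F (length w))}"
  define gen where "gen = (\<lambda>(i, w). act M (V i) (F (length w)) (mor i w) (x i))"
  have T_A: "i < length xs \<and> set w \<subseteq> A" if "(i, w) \<in> T" for i w
    using that by (auto simp: T_def A_def)

  \<comment> \<open>the arrow induced by \<open>g\<close> precomposes words with \<open>g\<close>\<close>
  have act_substitution:
    "(i, map ((!) w) g) \<in> T \<and>
      act M (F (length w)) (F (length g)) (word_map (F (length w)) (F (length g)) (P (length g))
        (map ((!) (P (length w))) g)) (gen (i, w)) = gen (i, map ((!) w) g)"
    if w: "(i, w) \<in> T" and g: "ordered_surj (length w) g" "length g \<in> D" for i w g
  proof -
    let ?n = "length w" and ?m = "length g"
    let ?g = "word_map (F ?n) (F ?m) (P ?m) (map ((!) (P ?n)) g)"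
    have i: "i < length xs" and n: "?n \<in> D" and w': "set w \<subseteq> functionals R (V i)"
      and mor: "mor i w \<in> Hom ?C (V i) (F ?n)" using w by (auto simp: T_def)
    have g_Hom: "?g \<in> Hom ?C (F ?n) (F ?m)"
      using g P n F by (intro word_map_ordered_surj_VI) simp_all
    have comp: "Comp ?C (V i) (F ?n) (F ?m) ?g (mor i w) = mor i (map ((!) w) g)"
      unfolding Comp_VI mor_def
      using compose_word_map[OF P(1)[OF n] P(1)[OF g(2)] w', of g] P(2) n g set_ordered_surj[OF g(1)]
      by simp
    have "Comp ?C (V i) (F ?n) (F ?m) ?g (mor i w) \<in> Hom ?C (V i) (F ?m)"
      by (rule VI.comp_hom[OF Vx(2)[OF i] F[OF n] F[OF g(2)] mor g_Hom])
    moreover have "set (map ((!) w) g) \<subseteq> functionals R (V i)"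
      using set_ordered_surj[OF g(1)] w' by (intro set_map_nth_subset) auto
    ultimately have "(i, map ((!) w) g) \<in> T" using i g(2) comp by (simp add: T_def)
    moreover have "act M (F ?n) (F ?m) ?g (gen (i, w)) = gen (i, map ((!) w) g)"
      using M.act_comp[OF Vx(2)[OF i] F[OF n] F[OF g(2)] mor g_Hom Vx(3)[OF i]] comp
      by (simp add: gen_def)
    ultimately show ?thesis by blast
  qed

  interpret G: groebner_presentation ?C k M D F T "\<lambda>(i, w). length w" gen "word_rank q d"
    "\<lambda>(i, w) (j, u). i = j \<and> inflates w u"
  proof (intro groebner_presentation.intro groebner_presentation_axioms.intro)
    show "cat_module ?C k M" "cring k" "noetherian_ring k" by fact+
  next
    fix t assume "t \<in> T"
    then obtain i w where t: "t = (i, w)" and T: "i < length xs" "length w \<in> D"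
      "mor i w \<in> Hom ?C (V i) (F (length w))" by (auto simp: T_def)
    show "gen t \<in> carrier (val M (F (case t of (i, w) \<Rightarrow> length w)))"
      using linear_map_closed[OF M.val_module M.val_module M.act_linear, OF _ _ _ _ T(3) Vx(3)]
        Vx(2) F T by (simp add: t gen_def)
  next
    fix n assume n: "n \<in> D"
    let ?S = "\<Union>(V, x)\<in>X. (\<lambda>f. act M V (F n) f x) ` Hom ?C V (F n)"
    have "?S \<subseteq> gen ` {t \<in> T. (case t of (i, w) \<Rightarrow> length w) = n}"
    proof
      fix y assume "y \<in> ?S"
      then obtain i f where i: "i < length xs" and f: "f \<in> Hom ?C (V i) (F n)"
        and y: "y = act M (V i) (F n) f (x i)"
        unfolding xs[symmetric] V_def x_def by (auto simp: in_set_conv_nth)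
      obtain w where "set w \<subseteq> functionals R (V i)" "length w = n" "f = word_map (V i) (F n) (P n) w"
        using linear_map_eq_word_map[OF P(1)[OF n] module_Obj_VI[OF Vx(2)[OF i]], of f] f P(2)[OF n]
        by (auto simp: Hom_VI splittable_injections_def)
      then have "(i, w) \<in> T" "length w = n" "y = gen (i, w)"
        using i f n y by (auto simp: T_def gen_def mor_def)
      then show "y \<in> gen ` {t \<in> T. (case t of (i, w) \<Rightarrow> length w) = n}" by force
    qed
    then have "generated_submodule k (val M (F n)) ?S
        \<subseteq> generated_submodule k (val M (F n)) (gen ` {t \<in> T. (case t of (i, w) \<Rightarrow> length w) = n})"
      unfolding generated_submodule_def by blast
    then show "carrier (val M (F n))
        \<subseteq> generated_submodule k (val M (F n)) (gen ` {t \<in> T. (case t of (i, w) \<Rightarrow> length w) = n})"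
      using M.cat_span_subset_generated[OF category_VI X(2) F[OF n]] X_gen F[OF n] by blast
  next
    fix n :: nat
    have "finite ({..<length xs} \<times> {w. set w \<subseteq> A \<and> length w = n})"
      using \<open>finite A\<close> by (intro finite_cartesian_product finite_lists_length_eq) auto
    then show "finite {t \<in> T. (case t of (i, w) \<Rightarrow> length w) = n}"
      using T_A by (elim rev_finite_subset) auto
  next
    fix s t assume st: "s \<in> T" "t \<in> T"
      "(case s of (i, w) \<Rightarrow> length w) = (case t of (i, w) \<Rightarrow> length w)" "word_rank q d s = word_rank q d t"
    obtain i w j u where [simp]: "s = (i, w)" "t = (j, u)" by (cases s, cases t)
    have "set w \<union> set u \<subseteq> A" using T_A st(1,2) by auto
    then have "\<forall>a\<in>set w \<union> set u. d a < q" "inj_on d (set w \<union> set u)"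
      using d by (auto intro: inj_on_subset)
    then show "s = t" using word_rank_inj[of w u d q i j] st by simp
  next
    have "T \<subseteq> {(i, w). i < length xs \<and> set w \<subseteq> A}" using T_A by auto
    then show "almost_full_on (\<lambda>(i, w) (j, u). i = j \<and> inflates w u) T"
      using almost_full_on_indexed_words[OF \<open>finite A\<close>, of "length xs"]
      unfolding almost_full_on_def by (meson subset_trans)
  next
    fix s t assume s: "s \<in> T" and t: "t \<in> T"
      and "(case s of (i, w) \<Rightarrow> \<lambda>(j, u). i = j \<and> inflates w u) t"
    then obtain i w u where st: "s = (i, w)" "t = (i, u)" and wu: "inflates w u"
      by (auto split: prod.splits)
    from inflates_imp_ordered_surj[OF wu]
    obtain g where g: "ordered_surj (length w) g" "u = map ((!) w) g" by blast
    have gD: "length g \<in> D" using t st g(2) by (auto simp: T_def)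
    let ?h = "word_map (F (length w)) (F (length u)) (P (length u)) (map ((!) (P (length w))) g)"
    have len: "length u = length g" using g(2) by simp
    have h: "?h \<in> Hom ?C (F (length w)) (F (length u))"
      using g P F gD s st len by (intro word_map_ordered_surj_VI) (auto simp: T_def)
    have below: "\<exists>v\<in>T. (case v of (i, w) \<Rightarrow> length w) = length u \<and> word_rank q d v < word_rank q d t \<and>
        act M (F (length w)) (F (length u)) ?h (gen v') = gen v"
      if v': "v' \<in> T" "(case v' of (i, w) \<Rightarrow> length w) = length w" "word_rank q d v' < word_rank q d s"
      for v'
    proof -
      obtain j z where jz: "v' = (j, z)" by (cases v')
      have "set z \<union> set w \<subseteq> A" using T_A v'(1) s st jz by auto
      then have "\<forall>a\<in>set z \<union> set w. d a < q" "inj_on d (set z \<union> set w)"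
        using d by (auto intro: inj_on_subset)
      then have "word_rank q d (j, map ((!) z) g) < word_rank q d t"
        using word_rank_ordered_surj_mono[OF g(1), of z w d q j i] v' jz st g(2) by simp
      then show ?thesis
        using act_substitution[of j z g] v' jz g(1) gD len
        by (intro bexI[of _ "(j, map ((!) z) g)"]) auto
    qed
    show "\<exists>h\<in>Hom ?C (F (case s of (i, w) \<Rightarrow> length w)) (F (case t of (i, w) \<Rightarrow> length w)).
        act M (F (case s of (i, w) \<Rightarrow> length w)) (F (case t of (i, w) \<Rightarrow> length w)) h (gen s) = gen t \<and>
        (\<forall>v'\<in>T. (case v' of (i, w) \<Rightarrow> length w) = (case s of (i, w) \<Rightarrow> length w) \<and>
            word_rank q d v' < word_rank q d s \<longrightarrow>
          (\<exists>v\<in>T. (case v of (i, w) \<Rightarrow> length w) = (case t of (i, w) \<Rightarrow> length w) \<and>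
            word_rank q d v < word_rank q d t \<and>
            act M (F (case s of (i, w) \<Rightarrow> length w)) (F (case t of (i, w) \<Rightarrow> length w)) h (gen v') = gen v))"
    proof (rule bexI[of _ ?h])
      show "?h \<in> Hom ?C (F (case s of (i, w) \<Rightarrow> length w)) (F (case t of (i, w) \<Rightarrow> length w))"
        using h by (simp add: st)
    qed (use below act_substitution[of i w g] s g gD len in \<open>simp add: st\<close>)
  qed (use F in \<open>auto simp: T_def\<close>)

  obtain Y where Y: "finite Y" "Y \<subseteq> (SIGMA n:D. N (F n))"
    and Y_gen: "\<forall>N'. cat_submodule ?C k M N' \<longrightarrow> (\<forall>V\<in>Obj ?C. N' V \<subseteq> N V) \<longrightarrow>
      (\<forall>(n, y)\<in>Y. y \<in> N' (F n)) \<longrightarrow> (\<forall>n\<in>D. N (F n) \<subseteq> N' (F n))"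
    using G.finitely_determined[OF N] by (elim exE conjE)
  let ?Y = "(\<lambda>(n, y). (F n, y)) ` Y"
  have everything: "N W \<subseteq> N' W"
    if N': "cat_submodule ?C k (restrict_module M N) N'" "\<forall>(V, y)\<in>?Y. y \<in> N' V" and W: "W \<in> Obj ?C"
    for N' W
  proof -
    note N'_M = M.cat_submodule_of_restrict_module[OF N N'(1)]
    obtain ps where ps: "coordinate_system R W ps" using ex_coordinate_system_Obj_VI[OF W] by blast
    then have n: "length ps \<in> D" using W by (auto simp: D_def)
    then have "N (F (length ps)) \<subseteq> N' (F (length ps))"
      using N'_M N'(2) by (intro Y_gen[rule_format]) auto
    with P(2)[OF n] show ?thesis
      by (intro cat_submodule_VI_subset_transfer[OF M N N'_M(1) F[OF n] P(1)[OF n] W ps]) auto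
  qed
  have carrier: "carrier (val (restrict_module M N) W) = N W" for W by (simp add: restrict_module_def)
  have "cat_span ?C k (restrict_module M N) ?Y W = N W" if W: "W \<in> Obj ?C" for W
  proof
    show "N W \<subseteq> cat_span ?C k (restrict_module M N) ?Y W"
      unfolding cat_span_def using everything[OF _ _ W] by blast
    interpret RN: cat_module ?C k "restrict_module M N" using N by (rule M.cat_module_restrict_module)
    have "cat_submodule ?C k (restrict_module M N) N" using RN.cat_submodule_carrier by (simp add: carrier)
    moreover have "\<forall>(V, y)\<in>?Y. y \<in> N V" using Y(2) by auto
    ultimately show "cat_span ?C k (restrict_module M N) ?Y W \<subseteq> N W"
      unfolding cat_span_def by blast
  qed
  then show "finitely_generated ?C k (restrict_module M N)"
    using Y F unfolding finitely_generated_def carrier by (intro exI[of _ ?Y]) auto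
qed

end
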